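(* Let $q=1/d$, where $d\in\mathbb{Z}$ with $|d|\ge 2$, and let $t=u/v\in\mathbb{Q}$, where $u\in\mathbb{Z}$, $v\in\mathbb{Z}_{>0}$, $\gcd(u,v)=1$ and $0<|t|<1$. Define \[ c_4=\frac{14\log v}{3\log|d|}\left(\frac{4}{3}\log v+\sqrt{(\log 4)\log|d|}\right)+8\sqrt{(\log 4)\log|d|}+\log\Big(2^7v^{44/3}|d|^8\prod_{k=0}^{\infty}\big(1+2^{-k}\big)\Big), \] and $C_1=C_1(d,v)=e^{-c_4}$. Then \[ \left|E_q(t)-\frac{M}{N}\right|\ge C_1\,(2|N|)^{-\left(\frac{7}{3}+\varepsilon_1\right)} \] holds for all $M,N\in\mathbb{Z}$ with $|N|\ge 1$, where \[ \varepsilon_1=\varepsilon_1(v,d,N)=\frac{\frac{22}{3}\log v+8\log|d|+4\sqrt{(\log 4)\log|d|}}{\sqrt{\frac{3}{2}(\log|d|)\log(2|N|)}}. \]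
   Context: For $0<|q|<1$ and $|t|<1$, the $q$-exponential function is \[ E_q(t)=\sum_{k=0}^{\infty}\frac{t^k}{\prod_{n=1}^{k}(1-q^n)}=\prod_{k=0}^{\infty}\frac{1}{1-q^kt}. \] *)

theory Defs
  imports "HOL-Analysis.Analysis"
begin

definition q_exp :: "'a \<Rightarrow> 'a \<Rightarrow> 'a::{real_normed_field, banach}" where
  "q_exp q t = (\<Sum>k. t ^ k / (\<Prod>n=1..k. 1 - q ^ n))"

definition c4 :: "int \<Rightarrow> int \<Rightarrow> real" where
  "c4 d v =
     14 * ln (of_int v) / (3 * ln \<bar>of_int d\<bar>)
       * (4 / 3 * ln (of_int v) + sqrt (ln 4 * ln \<bar>of_int d\<bar>))
     + 8 * sqrt (ln 4 * ln \<bar>of_int d\<bar>)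
     + ln (2 ^ 7 * of_int v powr (44 / 3) * \<bar>of_int d\<bar> ^ 8
           * (\<Prod>k. 1 + 1 / 2 ^ k))"

definition C1 :: "int \<Rightarrow> int \<Rightarrow> real" where
  "C1 d v = exp (- c4 d v)"

definition eps1 :: "int \<Rightarrow> int \<Rightarrow> int \<Rightarrow> real" where
  "eps1 v d N =
     (22 / 3 * ln (of_int v) + 8 * ln \<bar>of_int d\<bar> + 4 * sqrt (ln 4 * ln \<bar>of_int d\<bar>))
     / sqrt (3 / 2 * ln \<bar>of_int d\<bar> * ln (2 * \<bar>of_int N\<bar>))"

end

theory Submission
  imports Defs
begin

text \<open>
  The diagonal Pade approximants of the q-exponential function are explicit: the q-Vandermonde
  identity yields a denominator \<open>Q\<^sub>n\<close> turning the coefficient of \<open>z\<^sup>k\<close> in \<open>Q\<^sub>n(z) E\<^sub>q(z)\<close>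
  into \<open>\<Prod>\<^sub>l (q\<^sup>k - q\<^bsup>n+l\<^esup>) / \<Prod>\<^sub>i (1 - q\<^sup>i)\<close> (\<open>1 \<le> l \<le> n\<close>, \<open>1 \<le> i \<le> k\<close>), which vanishes for
  \<open>n < k \<le> 2n\<close>. One evaluates at \<open>z = q\<^sup>n t\<close> and returns to \<open>t\<close> by the functional equation
  \<open>E\<^sub>q(q t) = (1 - t) E\<^sub>q(t)\<close>. Multiplication by \<open>v\<^bsup>2n\<^esup> d\<^bsup>2n\<^sup>2\<^esup>\<close> makes both coefficients
  integers, and the resulting linear form in \<open>1\<close> and \<open>E\<^sub>q(t)\<close> has size about
  \<open>v\<^bsup>2n\<^esup> |d|\<^bsup>-3n(n+1)/2\<^esup>\<close>; hence the exponent \<open>1 + 2 / (3/2) = 7/3\<close>.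

  The first term of the remainder series dominates, so the errors of two consecutive approximants
  have different sizes. Thus \<open>M/N\<close> differs from one of them, and comparing with that one gives the
  bound. The index \<open>n\<close> is the least one for which the linear form is smaller than \<open>1/(2|N|)\<close>.
\<close>

section \<open>Gaussian binomial coefficients\<close>

text \<open>The q-Pascal rule is taken as the definition: it involves no division, so integrality
  and bounds follow by induction, and it makes sense in every commutative ring.\<close>

fun qbinom :: "'a::comm_ring_1 \<Rightarrow> nat \<Rightarrow> nat \<Rightarrow> 'a" where
  "qbinom q n 0 = 1"
| "qbinom q 0 (Suc k) = 0"
| "qbinom q (Suc n) (Suc k) = qbinom q n k + q ^ Suc k * qbinom q n (Suc k)"

lemma qbinom_eq_0: "n < k \<Longrightarrow> qbinom q n k = 0"
  by (induction q n k rule: qbinom.induct) auto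

text \<open>The Pascal rule in summed form, with an arbitrary weight \<open>g\<close>; it is the
  induction step of both q-identities below.\<close>

lemma sum_qbinom_Suc:
  "(\<Sum>j\<le>Suc n. qbinom q (Suc n) j * g j) = (\<Sum>j\<le>n. qbinom q n j * (q ^ j * g j + g (Suc j)))"
proof -
  have "(\<Sum>j\<le>Suc n. qbinom q (Suc n) j * g j)
      = g 0 + (\<Sum>j\<le>n. qbinom q n j * g (Suc j)) + (\<Sum>j\<le>n. q ^ Suc j * qbinom q n (Suc j) * g (Suc j))"
    by (subst sum.atMost_Suc_shift) (simp add: sum.distrib algebra_simps)
  also have "(\<Sum>j\<le>n. q ^ Suc j * qbinom q n (Suc j) * g (Suc j))
      = (\<Sum>j\<le>Suc n. q ^ j * qbinom q n j * g j) - g 0"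
    by (subst sum.atMost_Suc_shift) simp
  also have "(\<Sum>j\<le>Suc n. q ^ j * qbinom q n j * g j) = (\<Sum>j\<le>n. q ^ j * qbinom q n j * g j)"
    by (simp add: qbinom_eq_0)
  finally show ?thesis
    by (simp add: sum.distrib algebra_simps)
qed

lemma q_vandermonde:
  "(\<Sum>j\<le>n. qbinom q n j * ((\<Prod>i<j. x - z * q ^ i) * (\<Prod>i<n-j. z - w * q ^ i)))
     = (\<Prod>i<n. x - w * q ^ i)"
proof (induction n)
  case (Suc n)
  let ?f = "\<lambda>j. \<Prod>i<j. x - z * q ^ i"
  let ?g = "\<lambda>j. \<Prod>i<j. z - w * q ^ i"
  have "(\<Sum>j\<le>Suc n. qbinom q (Suc n) j * (?f j * ?g (Suc n - j)))
      = (\<Sum>j\<le>n. qbinom q n j * (q ^ j * (?f j * ?g (Suc n - j)) + ?f (Suc j) * ?g (Suc n - Suc j)))"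
    by (rule sum_qbinom_Suc)
  also have "\<dots> = (\<Sum>j\<le>n. qbinom q n j * (?f j * ?g (n - j)) * (x - w * q ^ n))"
  proof (rule sum.cong)
    fix j assume "j \<in> {..n}"
    hence j: "Suc n - j = Suc (n - j)" "q ^ n = q ^ j * q ^ (n - j)"
      by (auto simp flip: power_add)
    \<comment> \<open>The two terms combine because
      \<open>q^j * (z - w * q^(n-j)) + (x - z * q^j) = x - w * q^n\<close>, which no longer depends
      on \<open>j\<close> or \<open>z\<close>.\<close>
    show "qbinom q n j * (q ^ j * (?f j * ?g (Suc n - j)) + ?f (Suc j) * ?g (Suc n - Suc j))
        = qbinom q n j * (?f j * ?g (n - j)) * (x - w * q ^ n)"
      unfolding j by (simp add: algebra_simps)
  qed auto
  also have "\<dots> = (\<Prod>i<Suc n. x - w * q ^ i)"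
    by (simp add: Suc.IH flip: sum_distrib_right)
  finally show ?case .
qed auto

text \<open>The finite q-binomial theorem. The product on the left is
  \<open>y^j * q^(j(j-1)/2)\<close>; the induction replaces \<open>y\<close> by
  \<open>y * q\<close>. It later resums termwise estimates into a product.\<close>

lemma q_binomial:
  "(\<Sum>j\<le>n. qbinom q n j * (\<Prod>i<j. y * q ^ i)) = (\<Prod>i<n. 1 + y * q ^ i)"
proof (induction n arbitrary: y)
  case (Suc n)
  have "(\<Sum>j\<le>Suc n. qbinom q (Suc n) j * (\<Prod>i<j. y * q ^ i))
      = (\<Sum>j\<le>n. qbinom q n j * (q ^ j * (\<Prod>i<j. y * q ^ i) + (\<Prod>i<Suc j. y * q ^ i)))"
    by (rule sum_qbinom_Suc)
  also have "\<dots> = (\<Sum>j\<le>n. qbinom q n j * (\<Prod>i<j. y * q * q ^ i) * (1 + y))"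
  proof (rule sum.cong)
    fix j
    have "(\<Prod>i<j. y * q * q ^ i) = q ^ j * (\<Prod>i<j. y * q ^ i)"
      by (induction j) (auto simp: algebra_simps)
    moreover have "(\<Prod>i<Suc j. y * q ^ i) = y * (\<Prod>i<j. y * q * q ^ i)"
      by (subst prod.lessThan_Suc_shift) (simp add: mult_ac)
    ultimately show "qbinom q n j * (q ^ j * (\<Prod>i<j. y * q ^ i) + (\<Prod>i<Suc j. y * q ^ i))
        = qbinom q n j * (\<Prod>i<j. y * q * q ^ i) * (1 + y)"
      by (simp add: algebra_simps)
  qed auto
  also have "\<dots> = (\<Prod>i<n. 1 + y * q * q ^ i) * (1 + y)"
    by (simp only: Suc.IH flip: sum_distrib_right)
  also have "\<dots> = (\<Prod>i<Suc n. 1 + y * q ^ i)"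
    by (subst prod.lessThan_Suc_shift) (simp add: mult_ac)
  finally show ?case .
qed auto

section \<open>The q-Pochhammer symbol \<open>(q;q)_n\<close> and the closed form of
  \<open>qbinom\<close>\<close>

definition qpoch :: "'a::comm_ring_1 \<Rightarrow> nat \<Rightarrow> 'a" where
  "qpoch q n = (\<Prod>i=1..n. 1 - q ^ i)"

lemma qpoch_0 [simp]: "qpoch q 0 = 1"
  by (simp add: qpoch_def)

lemma qpoch_Suc: "qpoch q (Suc n) = qpoch q n * (1 - q ^ Suc n)"
  by (simp add: qpoch_def)

lemma qpoch_add: "qpoch q (n + m) = qpoch q n * (\<Prod>i<m. 1 - q ^ (n + 1 + i))"
  by (induction m) (auto simp: qpoch_Suc mult_ac)

text \<open>Cleared of denominators, the closed form follows from the Pascal rule and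
  \<open>(1 - q^k) + q^k * (1 - q^m) = 1 - q^(k+m)\<close>, by induction on
  \<open>k + m\<close>.\<close>

lemma qbinom_qpoch: "qbinom q (k + m) k * (qpoch q k * qpoch q m) = qpoch q (k + m)"
proof (induction "k + m" arbitrary: k m)
  case (Suc l)
  show ?case
  proof (cases k)
    case (Suc k')
    show ?thesis
    proof (cases m)
      case 0
      have "qbinom q k k = 1" for k
        by (induction k) (auto simp: qbinom_eq_0)
      thus ?thesis using 0 by simp
    next
      case (Suc m')
      have l: "l = k' + m" "l = k + m'" "k + m = Suc l"
        using Suc \<open>k = Suc k'\<close> \<open>Suc l = k + m\<close> by auto
      have 1: "qbinom q l k' * (qpoch q k' * qpoch q m) = qpoch q l"
        using Suc.hyps(1)[OF l(1)] l(1) by simp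
      have 2: "qbinom q l k * (qpoch q k * qpoch q m') = qpoch q l"
        using Suc.hyps(1)[OF l(2)] l(2) by simp
      have b: "qbinom q (k + m) k = qbinom q l k' + q ^ k * qbinom q l k"
        unfolding l(3) \<open>k = Suc k'\<close> by (simp add: l(1))
      have pk: "qpoch q k = qpoch q k' * (1 - q ^ k)"
        unfolding \<open>k = Suc k'\<close> by (rule qpoch_Suc)
      have pm: "qpoch q m = qpoch q m' * (1 - q ^ m)"
        unfolding \<open>m = Suc m'\<close> by (rule qpoch_Suc)
      have "qbinom q (k + m) k * (qpoch q k * qpoch q m)
         = (qbinom q l k' * (qpoch q k' * qpoch q m)) * (1 - q ^ k)
           + q ^ k * (1 - q ^ m) * (qbinom q l k * (qpoch q k * qpoch q m'))"
        by (simp add: b pk pm algebra_simps)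
      also have "\<dots> = qpoch q l * (1 - q ^ (k + m))"
        unfolding 1 2 by (simp add: algebra_simps power_add)
      finally show ?thesis unfolding l(3) by (simp add: qpoch_Suc)
    qed
  qed auto
qed auto

text \<open>Pulling \<open>-(q^i)\<close> out of each factor leaves \<open>1 - q^(k+j-i)\<close>,
  whose exponents run through \<open>k+1, ..., k+j\<close>.\<close>

lemma prod_diff_powers_qpoch:
  "(\<Prod>i<j. q ^ (k + j) - q ^ i) * qpoch q k = (\<Prod>i<j. - (q ^ i)) * qpoch q (k + j)"
proof (induction j)
  case (Suc j)
  have "(\<Prod>i<Suc j. q ^ (k + Suc j) - q ^ i) = (q ^ (k + Suc j) - 1) * (\<Prod>i<j. q * (q ^ (k + j) - q ^ i))"
    by (subst prod.lessThan_Suc_shift) (simp add: algebra_simps)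
  also have "(\<Prod>i<j. q * (q ^ (k + j) - q ^ i)) = q ^ j * (\<Prod>i<j. q ^ (k + j) - q ^ i)"
    by (simp add: prod.distrib)
  finally have "(\<Prod>i<Suc j. q ^ (k + Suc j) - q ^ i) * qpoch q k
      = (q ^ (k + Suc j) - 1) * q ^ j * ((\<Prod>i<j. q ^ (k + j) - q ^ i) * qpoch q k)"
    by (simp only: mult.assoc)
  also have "\<dots> = (\<Prod>i<Suc j. - (q ^ i)) * qpoch q (k + Suc j)"
    unfolding Suc.IH by (simp add: qpoch_Suc algebra_simps)
  finally show ?case .
qed auto

text \<open>As a polynomial in \<open>q\<close>, \<open>qbinom\<close> has nonnegative
  coefficients.\<close>

lemma abs_qbinom_le: "\<bar>qbinom (q::real) n k\<bar> \<le> qbinom \<bar>q\<bar> n k"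
proof (induction q n k rule: qbinom.induct)
  case (3 q n k)
  have "\<bar>qbinom q (Suc n) (Suc k)\<bar> \<le> \<bar>qbinom q n k\<bar> + \<bar>q ^ Suc k * qbinom q n (Suc k)\<bar>"
    unfolding qbinom.simps by (rule abs_triangle_ineq)
  also have "\<dots> \<le> qbinom \<bar>q\<bar> n k + \<bar>q\<bar> ^ Suc k * qbinom \<bar>q\<bar> n (Suc k)"
    using 3 by (intro add_mono) (auto simp: abs_mult power_abs intro!: mult_left_mono)
  finally show ?case by simp
qed auto

section \<open>Pade approximants\<close>

text \<open>The summands are those of \<open>q_vandermonde\<close> at \<open>x = q^k\<close>,
  \<open>z = 1\<close>, \<open>w = q^(n+1)\<close>, with \<open>\<Prod>i<j. q^k - q^i\<close>
  replaced by the factor by which it acts on the q-exponential series.\<close>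

definition pade_den :: "real \<Rightarrow> nat \<Rightarrow> real \<Rightarrow> real" where
  "pade_den q n z = (\<Sum>j\<le>n. qbinom q n j * ((\<Prod>i<j. - (z * q ^ i)) * (\<Prod>i<n-j. 1 - q ^ (n + 1 + i))))"

definition pade_term :: "real \<Rightarrow> nat \<Rightarrow> real \<Rightarrow> nat \<Rightarrow> real" where
  "pade_term q n z k = z ^ k * (\<Prod>i<n. q ^ k - q ^ (n + 1 + i)) / qpoch q k"

definition pade_num :: "real \<Rightarrow> nat \<Rightarrow> real \<Rightarrow> real" where
  "pade_num q n z = (\<Sum>k\<le>n. pade_term q n z k)"

text \<open>The series starts at \<open>2n+1\<close> because the terms strictly between
  \<open>n\<close> and \<open>2n+1\<close> vanish.\<close>

definition pade_rem :: "real \<Rightarrow> nat \<Rightarrow> real \<Rightarrow> real" where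
  "pade_rem q n z = (\<Sum>i. pade_term q n z (i + (2 * n + 1)))"

section \<open>Convergence and functional equation of the q-exponential series\<close>

lemma one_minus_power_nonzero:
  assumes "\<bar>q::real\<bar> < 1"
  shows "1 - q ^ Suc n \<noteq> 0"
proof -
  have "\<bar>q ^ Suc n\<bar> < 1"
    using assms power_less_one_iff[of "\<bar>q\<bar>" "Suc n"] by (simp add: power_abs del: power_Suc)
  thus ?thesis by linarith
qed

lemma qpoch_nonzero: "\<bar>q::real\<bar> < 1 \<Longrightarrow> qpoch q n \<noteq> 0"
proof (induction n)
  case (Suc n)
  thus ?case using one_minus_power_nonzero[of q n] by (simp add: qpoch_Suc)
qed auto

lemma q_exp_sums:
  assumes q: "\<bar>q::real\<bar> < 1" and t: "\<bar>t\<bar> < 1"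
  shows "(\<lambda>k. t ^ k / qpoch q k) sums q_exp q t"
proof -
  have "(\<lambda>n. q ^ Suc n) \<longlonglongrightarrow> 0"
    using q by (intro LIMSEQ_Suc LIMSEQ_power_zero) simp
  hence "(\<lambda>n. \<bar>t / (1 - q ^ Suc n)\<bar>) \<longlonglongrightarrow> \<bar>t / (1 - 0)\<bar>"
    by (intro tendsto_intros) auto
  moreover obtain c where c: "\<bar>t\<bar> < c" "c < 1"
    using t dense by blast
  ultimately have "eventually (\<lambda>n. \<bar>t / (1 - q ^ Suc n)\<bar> < c) sequentially"
    by (intro order_tendstoD) auto
  then obtain n0 where n0: "\<And>n. n \<ge> n0 \<Longrightarrow> \<bar>t / (1 - q ^ Suc n)\<bar> < c"
    by (auto simp: eventually_at_top_linorder)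
  have "summable (\<lambda>k. t ^ k / qpoch q k)"
  proof (rule summable_ratio_test[OF c(2)])
    fix n assume "n \<ge> n0"
    have "norm (t ^ Suc n / qpoch q (Suc n)) = \<bar>t / (1 - q ^ Suc n)\<bar> * norm (t ^ n / qpoch q n)"
      by (simp add: qpoch_Suc abs_mult)
    also have "\<dots> \<le> c * norm (t ^ n / qpoch q n)"
      using n0[OF \<open>n \<ge> n0\<close>] by (intro mult_right_mono) auto
    finally show "norm (t ^ Suc n / qpoch q (Suc n)) \<le> c * norm (t ^ n / qpoch q n)" .
  qed
  thus ?thesis
    unfolding q_exp_def qpoch_def by (rule summable_sums)
qed

lemma q_exp_shift:
  assumes q: "\<bar>q::real\<bar> < 1" and t: "\<bar>t\<bar> < 1"
  shows "q_exp q (q * t) = (1 - t) * q_exp q t"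
proof -
  \<comment> \<open>\<open>?f\<close> is the series of \<open>t * q_exp q t\<close> shifted by one
    index; subtracting it multiplies the \<open>k\<close>-th term of the q-exponential series by
    \<open>1 - (1 - q^k) = q^k\<close>.\<close>
  let ?f = "\<lambda>k. if k = 0 then 0 else t ^ k / qpoch q (k - 1)"
  have "(\<lambda>k. t * (t ^ k / qpoch q k)) sums (t * q_exp q t)"
    by (intro sums_mult q_exp_sums q t)
  also have "(\<lambda>k. t * (t ^ k / qpoch q k)) = (\<lambda>k. ?f (Suc k))"
    by auto
  finally have "?f sums (t * q_exp q t)"
    by (subst (asm) sums_Suc_iff) simp
  hence "(\<lambda>k. t ^ k / qpoch q k - ?f k) sums (q_exp q t - t * q_exp q t)"
    by (intro sums_diff q_exp_sums q t)
  also have "(\<lambda>k. t ^ k / qpoch q k - ?f k) = (\<lambda>k. (q * t) ^ k / qpoch q k)"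
  proof
    fix k
    show "t ^ k / qpoch q k - ?f k = (q * t) ^ k / qpoch q k"
    proof (cases k)
      case (Suc m)
      have "t ^ k / qpoch q m = t ^ k * (1 - q ^ k) / qpoch q k"
        using Suc one_minus_power_nonzero[OF q, of m] by (simp add: qpoch_Suc)
      moreover have "t ^ k / qpoch q k - t ^ k * (1 - q ^ k) / qpoch q k = (q * t) ^ k / qpoch q k"
        by (simp add: power_mult_distrib algebra_simps flip: diff_divide_distrib)
      ultimately show ?thesis using Suc by simp
    qed auto
  qed
  finally have "(\<lambda>k. (q * t) ^ k / qpoch q k) sums (q_exp q t - t * q_exp q t)" .
  moreover have "\<bar>q * t\<bar> < 1"
    using q t by (metis abs_mult abs_ge_zero mult.right_neutral mult_strict_mono' )
  hence "(\<lambda>k. (q * t) ^ k / qpoch q k) sums q_exp q (q * t)"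
    by (intro q_exp_sums q)
  ultimately show ?thesis
    using sums_unique2 by (fastforce simp: algebra_simps)
qed

lemma q_exp_shift_power:
  assumes q: "\<bar>q::real\<bar> < 1" and t: "\<bar>t\<bar> < 1"
  shows "q_exp q (q ^ n * t) = (\<Prod>k<n. 1 - q ^ k * t) * q_exp q t"
proof (induction n)
  case (Suc n)
  have "\<bar>q ^ n\<bar> \<le> 1" using q by (simp add: power_abs power_le_one)
  hence "\<bar>q ^ n\<bar> * \<bar>t\<bar> \<le> 1 * \<bar>t\<bar>" by (intro mult_right_mono) auto
  hence "\<bar>q ^ n * t\<bar> < 1" using t by (simp add: abs_mult)
  from q_exp_shift[OF q this] have "q_exp q (q * (q ^ n * t)) = (1 - q ^ n * t) * ((\<Prod>k<n. 1 - q ^ k * t) * q_exp q t)"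
    by (simp only: Suc.IH)
  thus ?case by (simp add: mult_ac)
qed auto

section \<open>The Pade identity\<close>

lemma sums_falling_factor_q_exp:
  assumes q: "\<bar>q::real\<bar> < 1" and z: "\<bar>z\<bar> < 1"
  shows "(\<lambda>k. z ^ k * (\<Prod>i<j. q ^ k - q ^ i) / qpoch q k) sums ((\<Prod>i<j. - (z * q ^ i)) * q_exp q z)"
    (is "?f sums ?s")
proof -
  \<comment> \<open>The extra product kills the terms with \<open>k < j\<close>, and after a shift
    by \<open>j\<close> every term is the same multiple of a term of the q-exponential
    series.\<close>
  have "(\<lambda>k. ?f (k + j)) = (\<lambda>k. (\<Prod>i<j. - (z * q ^ i)) * (z ^ k / qpoch q k))"
  proof
    fix k
    have *: "(\<Prod>i<j. - (z * q ^ i)) = z ^ j * (\<Prod>i<j. - (q ^ i))"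
      by (induction j) auto
    have "(\<Prod>i<j. q ^ (k + j) - q ^ i) / qpoch q (k + j) = (\<Prod>i<j. - (q ^ i)) / qpoch q k"
      using prod_diff_powers_qpoch[of q k j] qpoch_nonzero[OF q] by (simp add: frac_eq_eq)
    hence "?f (k + j) = z ^ (k + j) * ((\<Prod>i<j. - (q ^ i)) / qpoch q k)"
      by (metis times_divide_eq_right)
    thus "?f (k + j) = (\<Prod>i<j. - (z * q ^ i)) * (z ^ k / qpoch q k)"
      unfolding * by (simp add: power_add)
  qed
  hence "(\<lambda>k. ?f (k + j)) sums ?s"
    using sums_mult[OF q_exp_sums[OF q z]] by simp
  moreover have "?f k = 0" if "k < j" for k
    using that by (auto intro!: prod_zero)
  ultimately show ?thesis
    using sums_zero_iff_shift[of j ?f ?s] by blast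
qed

lemma pade_term_sums:
  assumes q: "\<bar>q\<bar> < 1" and z: "\<bar>z\<bar> < 1"
  shows "pade_term q n z sums (pade_den q n z * q_exp q z)"
proof -
  let ?w = "\<lambda>j. \<Prod>i<n-j. 1 - q ^ (n + 1 + i)"
  have "(\<lambda>k. \<Sum>j\<le>n. qbinom q n j * ?w j * (z ^ k * (\<Prod>i<j. q ^ k - q ^ i) / qpoch q k))
      sums (\<Sum>j\<le>n. qbinom q n j * ?w j * ((\<Prod>i<j. - (z * q ^ i)) * q_exp q z))"
    by (intro sums_sum sums_mult sums_falling_factor_q_exp q z)
  also have "(\<Sum>j\<le>n. qbinom q n j * ?w j * ((\<Prod>i<j. - (z * q ^ i)) * q_exp q z)) = pade_den q n z * q_exp q z"
    unfolding pade_den_def sum_distrib_right by (intro sum.cong) (auto simp: mult_ac)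
  also have "(\<lambda>k. \<Sum>j\<le>n. qbinom q n j * ?w j * (z ^ k * (\<Prod>i<j. q ^ k - q ^ i) / qpoch q k)) = pade_term q n z"
  proof
    fix k
    have "(\<Sum>j\<le>n. qbinom q n j * ?w j * (z ^ k * (\<Prod>i<j. q ^ k - q ^ i) / qpoch q k))
        = z ^ k / qpoch q k * (\<Sum>j\<le>n. qbinom q n j * ((\<Prod>i<j. q ^ k - 1 * q ^ i) * (\<Prod>i<n-j. 1 - q ^ (n + 1) * q ^ i)))"
      unfolding sum_distrib_left by (intro sum.cong) (auto simp: mult_ac power_add)
    also have "\<dots> = pade_term q n z k"
      unfolding q_vandermonde pade_term_def by (simp add: power_add mult_ac)
    finally show "(\<Sum>j\<le>n. qbinom q n j * ?w j * (z ^ k * (\<Prod>i<j. q ^ k - q ^ i) / qpoch q k)) = pade_term q n z k" .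
  qed
  finally show ?thesis .
qed

lemma pade_term_eq_0:
  assumes "n < k" "k \<le> 2 * n"
  shows "pade_term q n z k = 0"
proof -
  have "(\<Prod>i<n. q ^ k - q ^ (n + 1 + i)) = 0"
    using assms by (intro prod_zero bexI[of _ "k - n - 1"]) auto
  thus ?thesis by (simp add: pade_term_def)
qed

lemma pade_rem_sums:
  assumes q: "\<bar>q\<bar> < 1" and z: "\<bar>z\<bar> < 1"
  shows "(\<lambda>i. pade_term q n z (i + (2 * n + 1))) sums (pade_den q n z * q_exp q z - pade_num q n z)"
proof -
  have "pade_num q n z = (\<Sum>i<2*n+1. pade_term q n z i)"
    unfolding pade_num_def by (rule sum.mono_neutral_left) (auto simp: pade_term_eq_0)
  thus ?thesis
    using pade_term_sums[OF q z] by (subst sums_iff_shift) simp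
qed

lemma pade_rem_eq:
  assumes q: "\<bar>q\<bar> < 1" and z: "\<bar>z\<bar> < 1"
  shows "pade_rem q n z = pade_den q n z * q_exp q z - pade_num q n z"
  unfolding pade_rem_def using pade_rem_sums[OF q z] by (rule sums_unique[symmetric])

text \<open>For \<open>k \<le> n\<close> the division by \<open>qpoch q k\<close> cancels, leaving a
  polynomial in \<open>q\<close> and \<open>z\<close> with integer coefficients; this is what makes
  the numerators integral after scaling.\<close>

lemma pade_term_low_order:
  assumes q: "\<bar>q\<bar> < 1" and k: "k \<le> n"
  shows "pade_term q n z k = z ^ k * q ^ (k * n) * qbinom q n k * (\<Prod>i<n-k. 1 - q ^ (n + 1 + i))"
proof -
  define m where "m = n - k"
  have n: "n = k + m" using k by (simp add: m_def)
  have "(\<Prod>i<n. q ^ k - q ^ (n + 1 + i)) = (\<Prod>i<n. q ^ k * (1 - q ^ (m + 1 + i)))"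
    by (intro prod.cong) (auto simp: n algebra_simps power_add)
  also have "\<dots> = q ^ (k * n) * (\<Prod>i<n. 1 - q ^ (m + 1 + i))"
    by (simp add: prod.distrib power_mult)
  finally have p: "(\<Prod>i<n. q ^ k - q ^ (n + 1 + i)) = q ^ (k * n) * (\<Prod>i<n. 1 - q ^ (m + 1 + i))" .
  \<comment> \<open>Both sides equal \<open>qpoch q (n + m) * qpoch q n\<close>, split at
    \<open>m\<close> or at \<open>n\<close>.\<close>
  have "(\<Prod>i<n. 1 - q ^ (m + 1 + i)) * (qpoch q m * qpoch q n)
      = (\<Prod>i<m. 1 - q ^ (n + 1 + i)) * qpoch q n * qpoch q n"
    using qpoch_add[of q m n] qpoch_add[of q n m] by (simp add: add.commute mult_ac)
  also have "\<dots> = (\<Prod>i<m. 1 - q ^ (n + 1 + i)) * qbinom q n k * qpoch q k * (qpoch q m * qpoch q n)"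
    using qbinom_qpoch[of q k m] by (simp add: n mult_ac)
  finally have "(\<Prod>i<n. 1 - q ^ (m + 1 + i)) = (\<Prod>i<m. 1 - q ^ (n + 1 + i)) * qbinom q n k * qpoch q k"
    using qpoch_nonzero[OF q] by simp
  thus ?thesis
    unfolding pade_term_def p using qpoch_nonzero[OF q] by (simp add: m_def)
qed

section \<open>Integrality\<close>

text \<open>\<open>qbinom q n k\<close> is an integer polynomial in \<open>q\<close> of degree at
  most \<open>k * (n - k)\<close>; the Pascal rule respects this degree bound.\<close>

lemma qbinom_integral:
  assumes "d \<noteq> 0"
  shows "of_int d ^ (k * (n - k)) * qbinom (1 / of_int d :: real) n k \<in> \<int>"
proof (induction "1 / of_int d :: real" n k rule: qbinom.induct)
  case (3 n k)
  let ?q = "1 / of_int d :: real"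
  show ?case
  proof (cases "k < n")
    case True
    define m where "m = n - Suc k"
    have n: "n = Suc k + m" using True by (simp add: m_def)
    have "of_int d ^ (Suc k * (Suc n - Suc k)) * qbinom ?q (Suc n) (Suc k)
       = of_int d ^ (n - k) * (of_int d ^ (k * (n - k)) * qbinom ?q n k)
         + of_int d ^ (Suc k * (n - Suc k)) * qbinom ?q n (Suc k)"
      using assms by (simp add: n power_add field_simps)
    also have "\<dots> \<in> \<int>" using 3 by (intro Ints_add Ints_mult[OF _ 3(1)] 3(2)) auto
    finally show ?thesis .
  next
    case False
    thus ?thesis using 3 by (cases "n = k") (auto simp: qbinom_eq_0)
  qed
qed auto

lemma prod_one_minus_integral:
  assumes "d \<noteq> 0"
  shows "of_int d ^ (\<Sum>i<m. c + i) * (\<Prod>i<m. 1 - (1 / of_int d :: real) ^ (c + i)) \<in> \<int>"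
proof -
  have "of_int d ^ (\<Sum>i<m. c + i) * (\<Prod>i<m. 1 - (1 / of_int d :: real) ^ (c + i))
     = (\<Prod>i<m. of_int d ^ (c + i) - 1)"
    unfolding power_sum prod.distrib[symmetric] using assms
    by (intro prod.cong) (auto simp: algebra_simps power_one_over)
  also have "\<dots> \<in> \<int>" by (intro Ints_prod Ints_diff) auto
  finally show ?thesis .
qed

lemma two_sum_add: "2 * (\<Sum>i<m. c + i) + m = 2 * c * m + m * (m::nat)"
  by (induction m) (auto simp: algebra_simps)

lemma pade_den_integral:
  fixes d u v :: int
  assumes "d \<noteq> 0" "v > 0" and q: "q = 1 / of_int d" and t: "t = of_int u / of_int v"
  shows "of_int v ^ (2 * n) * of_int d ^ (2 * n\<^sup>2) * (pade_den q n (q ^ n * t) * (\<Prod>k<n. 1 - q ^ k * t)) \<in> \<int>"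
proof -
  \<comment> \<open>The exponent \<open>2n^2\<close> splits into \<open>h = n^2 + n(n+1)/2\<close>
    for the denominator and \<open>n(n-1)/2\<close> for the product from the functional equation;
    each takes one factor \<open>v^n\<close>.\<close>
  define h where "h = n * n + (\<Sum>i<n. 1 + i)"
  have h: "2 * n\<^sup>2 = h + (\<Sum>i<n. i)"
    using two_sum_add[of 1 n] two_sum_add[of 0 n] by (simp add: h_def power2_eq_square)
  have vp: "real_of_int v ^ j = (\<Prod>i<j. of_int v)" for j by simp
  have "of_int v ^ n * of_int d ^ (\<Sum>i<n. i) * (\<Prod>k<n. 1 - q ^ k * t) = (\<Prod>k<n. of_int v * of_int d ^ k - of_int u)"
    unfolding power_sum vp[of n] prod.distrib[symmetric]
    using \<open>d \<noteq> 0\<close> \<open>v > 0\<close> by (intro prod.cong) (auto simp: q t field_simps)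
  also have "\<dots> \<in> \<int>" by (intro Ints_prod Ints_diff) auto
  finally have 1: "of_int v ^ n * of_int d ^ (\<Sum>i<n. i) * (\<Prod>k<n. 1 - q ^ k * t) \<in> \<int>" .
  have "of_int v ^ n * of_int d ^ h * pade_den q n (q ^ n * t) \<in> \<int>"
    unfolding pade_den_def sum_distrib_left
  proof (rule Ints_sum)
    fix j assume "j \<in> {..n}"
    define m where "m = n - j"
    have n: "n = j + m" using \<open>j \<in> {..n}\<close> by (simp add: m_def)
    let ?e1 = "j * m" and ?e2 = "\<Sum>i<j. n + i" and ?e3 = "\<Sum>i<m. (n + 1) + i"
    \<comment> \<open>\<open>?e1\<close>, \<open>?e2\<close>, \<open>?e3\<close> clear the binomial
      and the two products; the surplus is exactly \<open>j\<close>.\<close>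
    have e: "h = j + ?e1 + ?e2 + ?e3"
      using two_sum_add[of n j] two_sum_add[of "n + 1" m] two_sum_add[of 1 n]
      unfolding h_def n by (simp add: algebra_simps)
    have A: "of_int v ^ j * of_int d ^ ?e2 * (\<Prod>i<j. - (q ^ n * t * q ^ i)) = (\<Prod>i<j. - of_int u)"
      unfolding power_sum vp[of j] prod.distrib[symmetric]
      using \<open>d \<noteq> 0\<close> \<open>v > 0\<close> by (intro prod.cong) (auto simp: q t field_simps power_add)
    have B: "of_int v ^ n * of_int d ^ h * (qbinom q n j * ((\<Prod>i<j. - (q ^ n * t * q ^ i)) * (\<Prod>i<n - j. 1 - q ^ (n + 1 + i))))
       = of_int v ^ m * of_int d ^ j * (of_int d ^ ?e1 * qbinom q n j)
          * (of_int v ^ j * of_int d ^ ?e2 * (\<Prod>i<j. - (q ^ n * t * q ^ i)))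
          * (of_int d ^ ?e3 * (\<Prod>i<m. 1 - q ^ (n + 1 + i)))"
      unfolding e m_def[symmetric] n power_add by (simp only: mult_ac add_diff_cancel_left')
    have C: "of_int d ^ ?e1 * qbinom q n j \<in> \<int>"
      using qbinom_integral[OF \<open>d \<noteq> 0\<close>, of j n] unfolding q m_def .
    have D: "of_int d ^ ?e3 * (\<Prod>i<m. 1 - q ^ (n + 1 + i)) \<in> \<int>"
      using prod_one_minus_integral[OF \<open>d \<noteq> 0\<close>, of "n + 1" m] unfolding q .
    show "of_int v ^ n * of_int d ^ h * (qbinom q n j * ((\<Prod>i<j. - (q ^ n * t * q ^ i)) * (\<Prod>i<n - j. 1 - q ^ (n + 1 + i)))) \<in> \<int>"
      unfolding B A by (rule Ints_mult[OF Ints_mult[OF Ints_mult[OF _ C] _] D]) auto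
  qed
  from Ints_mult[OF this 1] show ?thesis
    unfolding h power_add mult_2[of n] by (simp only: mult_ac)
qed

lemma pade_num_integral:
  fixes d u v :: int
  assumes "\<bar>d\<bar> \<ge> 2" "v > 0" and q: "q = 1 / of_int d" and t: "t = of_int u / of_int v"
  shows "of_int v ^ (2 * n) * of_int d ^ (2 * n\<^sup>2) * pade_num q n (q ^ n * t) \<in> \<int>"
  unfolding pade_num_def sum_distrib_left
proof (rule Ints_sum)
  have d: "d \<noteq> 0" using assms by auto
  have "\<bar>real_of_int d\<bar> \<ge> 2" using assms by linarith
  hence q1: "\<bar>q\<bar> < 1" unfolding q by (simp add: abs_divide divide_simps)
  fix k assume "k \<in> {..n}"
  define m where "m = n - k"
  have n: "n = k + m" using \<open>k \<in> {..n}\<close> by (simp add: m_def)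
  let ?e1 = "k * m" and ?e2 = "2 * k * n" and ?e3 = "\<Sum>i<m. (n + 1) + i"
  \<comment> \<open>Here \<open>?e2 = 2kn\<close> collects \<open>q^(nk)\<close> from the argument
    and \<open>q^(kn)\<close> from the coefficient. The slack in \<open>2n^2\<close> is
    \<open>m(m-1)/2\<close>.\<close>
  have "2 * (?e1 + ?e2 + ?e3) + m * (m - 1) = 4 * n\<^sup>2"
    using two_sum_add[of "n + 1" m] unfolding n
    by (cases m) (simp_all add: algebra_simps power2_eq_square)
  hence "2 * (?e1 + ?e2 + ?e3) \<le> 4 * n\<^sup>2" by (metis le_add1)
  hence "?e1 + ?e2 + ?e3 \<le> 2 * n\<^sup>2" by simp
  then obtain f where "2 * n\<^sup>2 = (?e1 + ?e2 + ?e3) + f"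
    using le_Suc_ex by blast
  hence e: "2 * n\<^sup>2 = f + ?e1 + ?e2 + ?e3" by simp
  have A: "of_int v ^ k * of_int d ^ ?e2 * ((q ^ n * t) ^ k * q ^ (k * n)) = of_int u ^ k"
    using d \<open>v > 0\<close> by (simp add: q t field_simps mult_2_right flip: power_mult power_add)
  have B: "of_int v ^ (2 * n) * of_int d ^ (2 * n\<^sup>2) * pade_term q n (q ^ n * t) k
      = of_int v ^ (n + m) * of_int d ^ f * (of_int d ^ ?e1 * qbinom q n k)
        * (of_int v ^ k * of_int d ^ ?e2 * ((q ^ n * t) ^ k * q ^ (k * n)))
        * (of_int d ^ ?e3 * (\<Prod>i<m. 1 - q ^ (n + 1 + i)))"
  proof -
    have v2: "of_int v ^ (2 * n) = (of_int v ^ (n + m) * of_int v ^ k :: real)"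
      unfolding power_add[symmetric] by (simp add: n mult_2 add_ac)
    show ?thesis
      unfolding pade_term_low_order[OF q1 \<open>k \<in> {..n}\<close>[simplified]] e m_def[symmetric] v2
        power_add[of "real_of_int d"]
      by (simp only: mult_ac)
  qed
  have C: "of_int d ^ ?e1 * qbinom q n k \<in> \<int>"
    using qbinom_integral[OF d, of k n] unfolding q m_def .
  have D: "of_int d ^ ?e3 * (\<Prod>i<m. 1 - q ^ (n + 1 + i)) \<in> \<int>"
    using prod_one_minus_integral[OF d, of "n + 1" m] unfolding q .
  show "of_int v ^ (2 * n) * of_int d ^ (2 * n\<^sup>2) * pade_term q n (q ^ n * t) k \<in> \<int>"
    unfolding B A by (rule Ints_mult[OF Ints_mult[OF Ints_mult[OF _ C] _] D]) auto
qed

section \<open>Size of denominators and remainders\<close>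

lemma geometric_sum_le:
  assumes "0 \<le> a" "a \<le> (1/2::real)"
  shows "(\<Sum>i<m. a ^ (c + i)) \<le> 2 * a ^ c"
proof -
  \<comment> \<open>The added term bounds the rest of the series and makes the induction go
    through.\<close>
  have "(\<Sum>i<m. a ^ (c + i)) + 2 * a ^ (c + m) \<le> 2 * a ^ c"
  proof (induction m)
    case (Suc m)
    have "a * a ^ (c + m) \<le> 1/2 * a ^ (c + m)"
      using assms by (intro mult_right_mono) auto
    thus ?case using Suc.IH by simp
  qed auto
  moreover have "0 \<le> a ^ (c + m)" using assms by simp
  ultimately show ?thesis by linarith
qed

lemma geometric_sum_Suc_le:
  assumes "0 \<le> a" "a \<le> (1/2::real)"
  shows "(\<Sum>i<m. a ^ (c + 1 + i)) \<le> a ^ c"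
proof -
  have "a * a ^ c \<le> 1/2 * a ^ c"
    using assms by (intro mult_right_mono) auto
  thus ?thesis using geometric_sum_le[OF assms, where m = m and c = "c + 1"] by simp
qed

lemma abs_prod_one_minus_le:
  assumes "\<bar>q::real\<bar> \<le> 1/2"
  shows "\<bar>\<Prod>i<m. 1 - q ^ (c + 1 + i)\<bar> \<le> exp (\<bar>q\<bar> ^ c)"
proof -
  have "\<bar>\<Prod>i<m. 1 - q ^ (c + 1 + i)\<bar> \<le> (\<Prod>i<m. exp (\<bar>q\<bar> ^ (c + 1 + i)))"
    unfolding abs_prod
  proof (rule prod_mono, safe)
    fix i
    have "\<bar>1 - q ^ (c + 1 + i)\<bar> \<le> 1 + \<bar>q ^ (c + 1 + i)\<bar>" by linarith
    also have "\<dots> \<le> exp (\<bar>q ^ (c + 1 + i)\<bar>)" by (rule exp_ge_add_one_self)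
    finally show "\<bar>1 - q ^ (c + 1 + i)\<bar> \<le> exp (\<bar>q\<bar> ^ (c + 1 + i))" by (simp only: power_abs)
  qed auto
  also have "\<dots> = exp (\<Sum>i<m. \<bar>q\<bar> ^ (c + 1 + i))" by (simp add: exp_sum)
  also have "\<dots> \<le> exp (\<bar>q\<bar> ^ c)"
    using geometric_sum_Suc_le[OF _ assms, where m = m and c = c] by simp
  finally show ?thesis .
qed

lemma abs_prod_one_minus_ge:
  assumes "\<bar>q::real\<bar> \<le> 1/2"
  shows "1 - \<bar>q\<bar> ^ c \<le> \<bar>\<Prod>i<m. 1 - q ^ (c + 1 + i)\<bar>"
proof -
  have *: "\<bar>q\<bar> ^ (c + 1 + i) \<le> 1" for i using assms by (intro power_le_one) auto
  have "1 - \<bar>q\<bar> ^ c \<le> 1 - (\<Sum>i<m. \<bar>q\<bar> ^ (c + 1 + i))"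
    using geometric_sum_Suc_le[OF _ assms, where m = m and c = c] by simp
  also have "\<dots> \<le> (\<Prod>i<m. 1 - \<bar>q\<bar> ^ (c + 1 + i))"
    using * by (intro Weierstrass_prod_ineq) auto
  also have "\<dots> \<le> \<bar>\<Prod>i<m. 1 - q ^ (c + 1 + i)\<bar>"
    unfolding abs_prod
  proof (rule prod_mono, safe)
    fix i
    have "1 - \<bar>q ^ (c + 1 + i)\<bar> \<le> \<bar>1 - q ^ (c + 1 + i)\<bar>" by linarith
    thus "1 - \<bar>q\<bar> ^ (c + 1 + i) \<le> \<bar>1 - q ^ (c + 1 + i)\<bar>" by (simp only: power_abs)
  qed (use * in auto)
  finally show ?thesis .
qed

lemma prod_one_plus_le:
  assumes "0 \<le> a" "a \<le> (1/2::real)"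
  shows "(\<Prod>i<m. 1 + a ^ n * a ^ i) \<le> exp (2 * a ^ n)"
proof -
  have "(\<Prod>i<m. 1 + a ^ n * a ^ i) \<le> exp (\<Sum>i<m. a ^ n * a ^ i)"
    using assms by (intro prod_le_exp_sum) auto
  also have "\<dots> \<le> exp (2 * a ^ n)"
    using geometric_sum_le[OF assms, where m = m and c = n] by (simp add: power_add)
  finally show ?thesis .
qed

lemma abs_prod_geometric_le:
  assumes "\<bar>z::real\<bar> \<le> y"
  shows "\<bar>\<Prod>i<j. - (z * q ^ i)\<bar> \<le> (\<Prod>i<j. y * \<bar>q\<bar> ^ i)"
  unfolding abs_prod using assms
  by (intro prod_mono) (auto simp: abs_mult power_abs intro!: mult_right_mono)

text \<open>Termwise bounds turn the sum into a q-binomial sum in \<open>\<bar>q\<bar>\<close>,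
  which resums to a product of size at most \<open>exp (2 * \<bar>q\<bar>^n)\<close>; the factors
  \<open>1 - q^(n+1+i)\<close> cost another \<open>exp (\<bar>q\<bar>^n)\<close>.\<close>

lemma abs_pade_den_le:
  assumes q: "\<bar>q\<bar> \<le> 1/2" and z: "\<bar>z\<bar> \<le> \<bar>q\<bar> ^ n"
  shows "\<bar>pade_den q n z\<bar> \<le> exp (3 * \<bar>q\<bar> ^ n)"
proof -
  let ?a = "\<bar>q\<bar>" and ?y = "\<bar>q\<bar> ^ n"
  have "\<bar>pade_den q n z\<bar> \<le> (\<Sum>j\<le>n. qbinom ?a n j * ((\<Prod>i<j. ?y * ?a ^ i) * exp ?y))"
    unfolding pade_den_def
  proof (rule order_trans[OF sum_abs], rule sum_mono)
    fix j
    show "\<bar>qbinom q n j * ((\<Prod>i<j. - (z * q ^ i)) * (\<Prod>i<n-j. 1 - q ^ (n + 1 + i)))\<bar>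
        \<le> qbinom ?a n j * ((\<Prod>i<j. ?y * ?a ^ i) * exp ?y)"
      unfolding abs_mult using order_trans[OF abs_ge_zero abs_qbinom_le]
      by (intro mult_mono abs_qbinom_le abs_prod_geometric_le z abs_prod_one_minus_le q)
        (auto intro!: mult_nonneg_nonneg prod_nonneg)
  qed
  also have "\<dots> = (\<Prod>i<n. 1 + ?y * ?a ^ i) * exp ?y"
    unfolding q_binomial[symmetric] sum_distrib_right by (simp add: mult_ac)
  also have "\<dots> \<le> exp (2 * ?y) * exp ?y"
    using prod_one_plus_le[of ?a n n] q by (intro mult_right_mono) auto
  also have "\<dots> = exp (3 * ?y)"
    by (simp flip: exp_add)
  finally show ?thesis .
qed

lemma exp_third_le: "exp (1/3::real) \<le> 3/2"
proof -
  have "1 - 1/3 \<le> exp (- (1/3::real))" using exp_ge_add_one_self[of "- (1/3::real)"] by simp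
  hence "exp (1/3::real) * (2/3) \<le> exp (1/3::real) * exp (- (1/3::real))" by simp
  also have "\<dots> = 1" by (simp flip: exp_add)
  finally show ?thesis by simp
qed

text \<open>The summand \<open>b\<close> at \<open>j = 0\<close> dominates: it has size at least 5/6
  and the others sum to at most 3/5 of it, leaving \<open>2/5 * 5/6 = 1/3\<close>.\<close>

lemma abs_pade_den_ge:
  assumes q: "\<bar>q\<bar> \<le> 1/2" and y: "\<bar>q\<bar> ^ n \<le> 1/6" and z: "\<bar>z\<bar> \<le> \<bar>q\<bar> ^ n"
  shows "1/3 \<le> \<bar>pade_den q n z\<bar>"
proof -
  let ?a = "\<bar>q\<bar>" and ?y = "\<bar>q\<bar> ^ n"
  define b where "b = (\<Prod>i<n. 1 - q ^ (n + 1 + i))"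
  have b: "5/6 \<le> \<bar>b\<bar>" unfolding b_def using abs_prod_one_minus_ge[OF q, of n n] y by linarith
  \<comment> \<open>This product is a partial product of \<open>b\<close>, and the missing factors
    multiply to at least 5/6.\<close>
  have le: "\<bar>\<Prod>i<n-j. 1 - q ^ (n + 1 + i)\<bar> \<le> 6/5 * \<bar>b\<bar>" if "j \<le> n" for j
  proof -
    have "b = (\<Prod>i<n-j. 1 - q ^ (n + 1 + i)) * (\<Prod>i<j. 1 - q ^ ((n + (n - j)) + 1 + i))"
    proof -
      have "(\<Prod>i<m+l. f i) = (\<Prod>i<m. f i) * (\<Prod>i<l. f (m + i))" for m l and f :: "nat \<Rightarrow> real"
        by (induction l) (auto simp: mult_ac)
      from this[of "\<lambda>i. 1 - q ^ (n + 1 + i)" "n - j" j] show ?thesis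
        using that by (simp add: b_def add_ac)
    qed
    hence "\<bar>b\<bar> = \<bar>\<Prod>i<n-j. 1 - q ^ (n + 1 + i)\<bar> * \<bar>\<Prod>i<j. 1 - q ^ ((n + (n - j)) + 1 + i)\<bar>"
      by (simp only: abs_mult)
    moreover have "5/6 \<le> \<bar>\<Prod>i<j. 1 - q ^ ((n + (n - j)) + 1 + i)\<bar>"
    proof -
      have "?a ^ (n + (n - j)) \<le> ?a ^ n" using q by (intro power_decreasing) auto
      thus ?thesis using abs_prod_one_minus_ge[OF q, where c = "n + (n - j)" and m = j] y by linarith
    qed
    ultimately have "\<bar>\<Prod>i<n-j. 1 - q ^ (n + 1 + i)\<bar> * (5/6) \<le> \<bar>b\<bar>"
      by (simp only: mult_left_mono abs_ge_zero)
    thus ?thesis by simp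
  qed
  define g where "g = (\<lambda>j. qbinom q n j * ((\<Prod>i<j. - (z * q ^ i)) * (\<Prod>i<n-j. 1 - q ^ (n + 1 + i))))"
  define G where "G = (\<lambda>j. qbinom ?a n j * (\<Prod>i<j. ?y * ?a ^ i))"
  have "\<bar>pade_den q n z - b\<bar> = \<bar>\<Sum>j\<in>{..n}-{0}. g j\<bar>"
    unfolding pade_den_def g_def[symmetric] by (subst sum.remove[of _ 0]) (auto simp: g_def b_def)
  also have "\<dots> \<le> (\<Sum>j\<in>{..n}-{0}. G j * (6/5 * \<bar>b\<bar>))"
  proof (rule order_trans[OF sum_abs], rule sum_mono)
    fix j assume "j \<in> {..n} - {0}"
    thus "\<bar>g j\<bar> \<le> G j * (6/5 * \<bar>b\<bar>)"
      unfolding abs_mult g_def G_def mult.assoc using order_trans[OF abs_ge_zero abs_qbinom_le]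
      by (intro mult_mono abs_qbinom_le abs_prod_geometric_le z le)
        (auto intro!: mult_nonneg_nonneg prod_nonneg)
  qed
  also have "\<dots> = ((\<Sum>j\<le>n. G j) - 1) * (6/5 * \<bar>b\<bar>)"
    unfolding sum_distrib_right[symmetric] by (subst sum.remove[of "{..n}" 0]) (auto simp: G_def)
  also have "(\<Sum>j\<le>n. G j) = (\<Prod>i<n. 1 + ?y * ?a ^ i)"
    unfolding G_def by (rule q_binomial)
  also have "((\<Prod>i<n. 1 + ?y * ?a ^ i) - 1) * (6/5 * \<bar>b\<bar>) \<le> (3/2 - 1) * (6/5 * \<bar>b\<bar>)"
  proof (intro mult_right_mono diff_right_mono)
    have "(\<Prod>i<n. 1 + ?y * ?a ^ i) \<le> exp (2 * ?y)"
      using q by (intro prod_one_plus_le) auto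
    also have "\<dots> \<le> exp (1/3)" using y by simp
    also have "\<dots> \<le> 3/2" by (rule exp_third_le)
    finally show "(\<Prod>i<n. 1 + ?y * ?a ^ i) \<le> 3/2" .
  qed auto
  also have "\<dots> = 3/5 * \<bar>b\<bar>" by simp
  finally show ?thesis using b abs_triangle_ineq2_sym[of b "pade_den q n z"] by linarith
qed

section \<open>Dominance of the first term of the remainder series\<close>

lemma pade_term_Suc:
  assumes "\<bar>q\<bar> < 1" "q \<noteq> 0"
  shows "pade_term q n z (Suc i + (2 * n + 1))
     = z * (1 - q ^ (n + 1 + i)) / ((1 - q ^ (2 * n + 2 + i)) * (1 - q ^ (i + 1))) * pade_term q n z (i + (2 * n + 1))"
proof -
  define k where "k = i + (2 * n + 1)"
  define W where "W = (\<lambda>k. \<Prod>i<n. q ^ k - q ^ (n + 1 + i))"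
  \<comment> \<open>Taking \<open>q\<close> out of each factor shifts the range of exponents by one,
    so \<open>W (Suc k)\<close> and \<open>W k\<close> share all but one factor.\<close>
  have "W (Suc k) = (\<Prod>i<n. q * (q ^ k - q ^ (n + i)))"
    unfolding W_def by (intro prod.cong) (auto simp: algebra_simps)
  hence 1: "W (Suc k) = q ^ n * (\<Prod>i<n. q ^ k - q ^ (n + i))"
    by (simp add: prod.distrib)
  have 2: "(\<Prod>i<n. q ^ k - q ^ (n + i)) * (q ^ k - q ^ (2 * n)) = (\<Prod>i<Suc n. q ^ k - q ^ (n + i))"
    by (simp add: mult_2)
  have 3: "(\<Prod>i<Suc n. q ^ k - q ^ (n + i)) = (q ^ k - q ^ n) * W k"
    unfolding W_def by (subst prod.lessThan_Suc_shift) simp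
  have a: "q ^ k - q ^ (2 * n) = - (q ^ (2 * n)) * (1 - q ^ (i + 1))"
    by (simp add: k_def power_add algebra_simps)
  have b: "q ^ k - q ^ n = - (q ^ n) * (1 - q ^ (n + 1 + i))"
    by (simp add: k_def power_add mult_2_right algebra_simps)
  have eq: "W (Suc k) * (q ^ k - q ^ (2 * n)) = q ^ n * ((q ^ k - q ^ n) * W k)"
    unfolding 1 using 2 3 by (simp only: mult.assoc)
  have "q ^ (2 * n) * (W (Suc k) * (1 - q ^ (i + 1))) = - (W (Suc k) * (q ^ k - q ^ (2 * n)))"
    unfolding a by simp
  also have "\<dots> = - (q ^ n * ((q ^ k - q ^ n) * W k))"
    by (simp only: eq)
  also have "\<dots> = q ^ (2 * n) * ((1 - q ^ (n + 1 + i)) * W k)"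
    unfolding b mult_2 power_add[of q n n] by simp
  finally have W: "W (Suc k) * (1 - q ^ (i + 1)) = (1 - q ^ (n + 1 + i)) * W k"
    using \<open>q \<noteq> 0\<close> by simp
  have nz: "1 - q ^ (i + 1) \<noteq> 0" "1 - q ^ (2 * n + 2 + i) \<noteq> 0"
    using one_minus_power_nonzero[OF assms(1), of i] one_minus_power_nonzero[OF assms(1), of "2 * n + 1 + i"]
    by simp_all
  have Wd: "W (Suc k) = (1 - q ^ (n + 1 + i)) * W k / (1 - q ^ (i + 1))"
    unfolding nonzero_eq_divide_eq[OF nz(1)] by (rule W)
  have qp: "qpoch q (Suc k) = qpoch q k * (1 - q ^ (2 * n + 2 + i))"
    by (simp add: qpoch_Suc k_def add_ac)
  have "pade_term q n z (Suc k) = z ^ Suc k * W (Suc k) / qpoch q (Suc k)"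
    by (simp add: pade_term_def W_def)
  also have "\<dots> = z * (1 - q ^ (n + 1 + i)) / ((1 - q ^ (2 * n + 2 + i)) * (1 - q ^ (i + 1))) * (z ^ k * W k / qpoch q k)"
    unfolding Wd qp by (simp add: mult_ac)
  also have "z ^ k * W k / qpoch q k = pade_term q n z k"
    by (simp add: pade_term_def W_def)
  finally show ?thesis by (simp only: k_def add_Suc)
qed

lemma abs_ratio_le:
  fixes z :: real
  assumes "\<bar>z\<bar> \<le> y" "\<bar>a\<bar> \<le> \<alpha>" "\<bar>b\<bar> \<le> \<beta>" "\<bar>c\<bar> \<le> \<gamma>" "\<beta> < 1" "\<gamma> < 1"
  shows "\<bar>z * (1 - a) / ((1 - b) * (1 - c))\<bar> \<le> y * (1 + \<alpha>) / ((1 - \<beta>) * (1 - \<gamma>))"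
  unfolding abs_mult abs_divide
proof (rule frac_le)
  show "\<bar>z\<bar> * \<bar>1 - a\<bar> \<le> y * (1 + \<alpha>)" using assms by (intro mult_mono) auto
  show "(1 - \<beta>) * (1 - \<gamma>) \<le> \<bar>1 - b\<bar> * \<bar>1 - c\<bar>" using assms by (intro mult_mono) auto
qed (use assms in auto)

lemma pade_ratio_le:
  fixes q z :: real
  assumes q: "\<bar>q\<bar> \<le> 1/2" and y: "\<bar>q\<bar> ^ n \<le> 1/3" and z: "\<bar>z\<bar> \<le> \<bar>q\<bar> ^ n"
  shows "\<bar>z * (1 - q ^ (n + 1 + i)) / ((1 - q ^ (2 * n + 2 + i)) * (1 - q ^ (i + 1)))\<bar>
           \<le> (if i = 0 then 4/7 else 41/100)"
proof -
  define a where "a = \<bar>q\<bar>"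
  define y where "y = a ^ n"
  define p where "p = a ^ (i + 1)"
  have a0: "0 \<le> a" "a \<le> 1/2" and z': "\<bar>z\<bar> \<le> y" using q z by (auto simp: a_def y_def)
  have nn: "0 \<le> y" "0 \<le> p" using a0 by (auto simp: y_def p_def)
  have A: "\<bar>q ^ (n + 1 + i)\<bar> = y * p" and B: "\<bar>q ^ (2 * n + 2 + i)\<bar> = (y * p) * (y * a)"
    and C: "\<bar>q ^ (i + 1)\<bar> = p"
    by (simp_all add: a_def y_def p_def power_abs abs_mult power_add mult_2 power2_eq_square)
  \<comment> \<open>\<open>n = 0\<close> is excluded by the hypothesis on
    \<open>\<bar>q\<bar>^n\<close>; \<open>n = 1\<close> gives \<open>y = a\<close>, and
    \<open>n \<ge> 2\<close> gives \<open>y \<le> a^2 \<le> 1/4\<close>. The value 4/7 is the bound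
    at \<open>y = 1/4\<close>, \<open>p = a = 1/2\<close>.\<close>
  have cases: "(y \<le> 1/3 \<and> a \<le> 1/3) \<or> y \<le> 1/4"
  proof (cases "n \<le> 1")
    case True
    thus ?thesis using assms(2) by (cases n) (auto simp: a_def y_def)
  next
    case False
    have "a ^ n \<le> a ^ 2" using False a0 by (intro power_decreasing) auto
    also have "\<dots> \<le> (1/2) ^ 2" using a0 by (intro power_mono) auto
    finally show ?thesis by (simp add: y_def power2_eq_square)
  qed
  have bound: "\<bar>z * (1 - q ^ (n + 1 + i)) / ((1 - q ^ (2 * n + 2 + i)) * (1 - q ^ (i + 1)))\<bar>
      \<le> Y * (1 + Y * P) / ((1 - (Y * P) * (Y * a1)) * (1 - P))"
    if "y \<le> Y" "p \<le> P" "a \<le> a1" "P < 1" "(Y * P) * (Y * a1) < 1" for Y P a1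
    using that z' nn a0
    by (intro abs_ratio_le) (unfold A B C, auto intro!: mult_mono mult_nonneg_nonneg)
  show ?thesis
  proof (cases "i = 0")
    case True
    hence "p = a" by (simp add: p_def)
    with cases have "(y \<le> 1/3 \<and> p \<le> 1/3 \<and> a \<le> 1/3) \<or> (y \<le> 1/4 \<and> p \<le> 1/2)" using a0 by auto
    thus ?thesis using bound[of "1/3" "1/3" "1/3"] bound[of "1/4" "1/2" "1/2"] a0 True by auto
  next
    case False
    have "p \<le> a ^ 2" unfolding p_def using False a0 by (intro power_decreasing) auto
    hence sq: "p \<le> b ^ 2" if "a \<le> b" for b
      using that a0 by (meson order_trans power_mono)
    have "(y \<le> 1/3 \<and> p \<le> 1/9 \<and> a \<le> 1/3) \<or> (y \<le> 1/4 \<and> p \<le> 1/4)"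
      using cases a0(2) sq[of "1/3"] sq[of "1/2"] by (auto simp: power2_eq_square)
    thus ?thesis using bound[of "1/3" "1/9" "1/3"] bound[of "1/4" "1/4" "1/2"] a0 False by auto
  qed
qed

text \<open>Comparison with a geometric series whose first ratio is kept separate, since a uniform
  ratio of 4/7 would not let the first term dominate.\<close>

lemma sums_diff_first_le:
  fixes f :: "nat \<Rightarrow> real"
  assumes s: "f sums s" and 0: "\<bar>f 1\<bar> \<le> \<rho>\<^sub>0 * \<bar>f 0\<bar>"
    and S: "\<And>i. \<bar>f (Suc (Suc i))\<bar> \<le> \<rho> * \<bar>f (Suc i)\<bar>" and \<rho>: "0 \<le> \<rho>" "\<rho> < 1"
  shows "\<bar>s - f 0\<bar> \<le> \<rho>\<^sub>0 / (1 - \<rho>) * \<bar>f 0\<bar>"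
proof -
  have le: "\<bar>f (Suc i)\<bar> \<le> \<rho>\<^sub>0 * \<bar>f 0\<bar> * \<rho> ^ i" for i
  proof (induction i)
    case (Suc i)
    show ?case using order_trans[OF S mult_left_mono[OF Suc \<rho>(1)]] by (simp add: mult_ac)
  qed (use 0 in simp)
  have g: "(\<lambda>i. \<rho>\<^sub>0 * \<bar>f 0\<bar> * \<rho> ^ i) sums (\<rho>\<^sub>0 * \<bar>f 0\<bar> * (1 / (1 - \<rho>)))"
    using \<rho> by (intro sums_mult geometric_sums) auto
  have "(\<lambda>i. f (Suc i)) sums (s - f 0)" using s by (subst sums_Suc_iff) simp
  hence "s - f 0 = (\<Sum>i. f (Suc i))" by (rule sums_unique)
  also have "norm \<dots> \<le> (\<Sum>i. \<rho>\<^sub>0 * \<bar>f 0\<bar> * \<rho> ^ i)"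
    using le by (intro norm_suminf_le sums_summable[OF g]) auto
  also have "\<dots> = \<rho>\<^sub>0 * \<bar>f 0\<bar> * (1 / (1 - \<rho>))" using g by (rule sums_unique[symmetric])
  finally show ?thesis by (simp add: mult_ac)
qed

text \<open>The order in \<open>q\<close> of the first remainder term at \<open>z = q^n t\<close>:
  \<open>n(2n+1)\<close> from the power of \<open>z\<close>, \<open>n(n+1)\<close> from taking
  \<open>q^(n+1)\<close> out of \<open>n\<close> factors, and the last sum from the factors
  \<open>q^n - q^i\<close>.\<close>

definition rem_exp :: "nat \<Rightarrow> nat" where
  "rem_exp n = n * (2 * n + 1) + n * (n + 1) + (\<Sum>i<n. i)"

lemma two_rem_exp: "2 * rem_exp n = 7 * n\<^sup>2 + 3 * n"
  using two_sum_add[of 0 n] by (simp add: rem_exp_def power2_eq_square algebra_simps)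

lemma abs_pade_term_first:
  assumes q: "\<bar>q\<bar> < 1"
  shows "\<bar>pade_term q n (q ^ n * t) (2 * n + 1)\<bar> * \<bar>\<Prod>i<n+1. 1 - q ^ (n + 1 + i)\<bar> = \<bar>t\<bar> ^ (2 * n + 1) * \<bar>q\<bar> ^ rem_exp n"
proof -
  have "(\<Prod>i<n. q ^ (2 * n + 1) - q ^ (n + 1 + i)) = (\<Prod>i<n. q ^ (n + 1) * (q ^ n - q ^ i))"
    by (intro prod.cong) (auto simp: algebra_simps power_add mult_2_right)
  also have "\<dots> = q ^ (n * (n + 1)) * (\<Prod>i<n. q ^ (0 + n) - q ^ i)"
    by (simp only: prod.distrib prod_constant card_lessThan power_mult[symmetric] mult.commute add_0)
  also have "(\<Prod>i<n. q ^ (0 + n) - q ^ i) = (\<Prod>i<n. - (q ^ i)) * qpoch q n"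
    using prod_diff_powers_qpoch[of q 0 n] by simp
  finally have W: "\<bar>\<Prod>i<n. q ^ (2 * n + 1) - q ^ (n + 1 + i)\<bar> = \<bar>q\<bar> ^ (n * (n + 1)) * \<bar>q\<bar> ^ (\<Sum>i<n. i) * \<bar>qpoch q n\<bar>"
    by (simp only: abs_mult abs_prod abs_minus_cancel power_abs power_sum mult.assoc)
  define P where "P = (\<Prod>i<n+1. 1 - q ^ (n + 1 + i))"
  have P: "qpoch q (2 * n + 1) = qpoch q n * P"
    using qpoch_add[of q n "n + 1"] by (simp add: mult_2 P_def)
  have z: "\<bar>q ^ n * t\<bar> ^ (2 * n + 1) = \<bar>q\<bar> ^ (n * (2 * n + 1)) * \<bar>t\<bar> ^ (2 * n + 1)"
    by (simp only: abs_mult power_mult_distrib power_abs power_mult)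
  have nz: "\<bar>qpoch q n\<bar> \<noteq> 0" "\<bar>P\<bar> \<noteq> 0"
    using P qpoch_nonzero[OF q, of n] qpoch_nonzero[OF q, of "2 * n + 1"] by auto
  have cancel: "a * b * (c * e * g) / (g * p) * p = b * (a * c * e)" if "g \<noteq> 0" "p \<noteq> 0" for a b c e g p :: real
    using that by simp
  have "\<bar>pade_term q n (q ^ n * t) (2 * n + 1)\<bar>
      = \<bar>q ^ n * t\<bar> ^ (2 * n + 1) * \<bar>\<Prod>i<n. q ^ (2 * n + 1) - q ^ (n + 1 + i)\<bar> / \<bar>qpoch q (2 * n + 1)\<bar>"
    by (simp only: pade_term_def abs_mult abs_divide power_abs)
  thus ?thesis
    unfolding P_def[symmetric] W P z abs_mult[of "qpoch q n"] rem_exp_def power_add[of "\<bar>q\<bar>"]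
    by (simp only: cancel nz not_False_eq_True)
qed

lemma abs_pade_rem_bounds:
  assumes q: "\<bar>q\<bar> \<le> 1/2" "q \<noteq> 0" and y: "\<bar>q\<bar> ^ n \<le> 1/3" and t: "\<bar>t\<bar> < 1"
  shows "\<bar>t\<bar> ^ (2 * n + 1) * \<bar>q\<bar> ^ rem_exp n / 50 \<le> \<bar>pade_rem q n (q ^ n * t)\<bar>"
    and "\<bar>pade_rem q n (q ^ n * t)\<bar> \<le> 3 * (\<bar>t\<bar> ^ (2 * n + 1) * \<bar>q\<bar> ^ rem_exp n)"
proof -
  define z where "z = q ^ n * t"
  define f where "f = (\<lambda>i. pade_term q n z (i + (2 * n + 1)))"
  have q1: "\<bar>q\<bar> < 1" using q by simp
  have "\<bar>q ^ n\<bar> * \<bar>t\<bar> \<le> \<bar>q ^ n\<bar> * 1" using t by (intro mult_left_mono) auto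
  hence z: "\<bar>z\<bar> \<le> \<bar>q\<bar> ^ n" by (simp add: z_def abs_mult power_abs)
  hence z1: "\<bar>z\<bar> < 1" using y by simp
  have s: "f sums pade_rem q n z"
    unfolding f_def pade_rem_eq[OF q1 z1] by (rule pade_rem_sums[OF q1 z1])
  have ratio: "\<bar>f (Suc i)\<bar> \<le> (if i = 0 then 4/7 else 41/100) * \<bar>f i\<bar>" for i
    unfolding f_def pade_term_Suc[OF q1 q(2)] abs_mult[of "_ / _"]
    by (intro mult_right_mono pade_ratio_le q y z) auto
  have "\<bar>pade_rem q n z - f 0\<bar> \<le> (4/7) / (1 - 41/100) * \<bar>f 0\<bar>"
    using ratio[of 0] ratio[of "Suc _"] by (intro sums_diff_first_le[OF s]) auto
  \<comment> \<open>The relative error is \<open>(4/7) / (59/100) = 400/413\<close>, so at least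
    13/413 of the first term survives.\<close>
  hence R: "3/100 * \<bar>f 0\<bar> \<le> \<bar>pade_rem q n z\<bar>" "\<bar>pade_rem q n z\<bar> \<le> 2 * \<bar>f 0\<bar>"
    by (auto simp: abs_if split: if_splits)
  define w where "w = \<bar>\<Prod>i<n+1. 1 - q ^ (n + 1 + i)\<bar>"
  have "exp (\<bar>q\<bar> ^ n) \<le> 3/2" using y exp_third_le by (smt (verit) exp_le_cancel_iff)
  hence w: "2/3 \<le> w" "w \<le> 3/2"
    using abs_prod_one_minus_ge[OF q(1), of n "n + 1"] abs_prod_one_minus_le[OF q(1), where c = n and m = "n + 1"] y
    by (simp_all add: w_def)
  define T where "T = \<bar>t\<bar> ^ (2 * n + 1) * \<bar>q\<bar> ^ rem_exp n"
  have fw: "\<bar>f 0\<bar> * w = T"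
    using abs_pade_term_first[OF q1, of n t] by (simp add: f_def z_def w_def T_def)
  have "T \<le> \<bar>f 0\<bar> * (3/2)" unfolding fw[symmetric] using w by (intro mult_left_mono) auto
  moreover have "\<bar>f 0\<bar> * (2/3) \<le> T" unfolding fw[symmetric] using w by (intro mult_left_mono) auto
  ultimately show "\<bar>t\<bar> ^ (2 * n + 1) * \<bar>q\<bar> ^ rem_exp n / 50 \<le> \<bar>pade_rem q n (q ^ n * t)\<bar>"
    "\<bar>pade_rem q n (q ^ n * t)\<bar> \<le> 3 * (\<bar>t\<bar> ^ (2 * n + 1) * \<bar>q\<bar> ^ rem_exp n)"
    unfolding T_def[symmetric] z_def[symmetric] using R by linarith+
qed

lemma rem_exp_Suc: "rem_exp (Suc n) = rem_exp n + (7 * n + 5)"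
  using two_rem_exp[of n] two_rem_exp[of "Suc n"] by (simp add: power2_eq_square)

text \<open>Cross-multiplied comparison of the errors of two consecutive approximants, whose
  functional-equation products differ by the factor \<open>1 - q^n * t\<close>. Passing to
  \<open>Suc n\<close> adds \<open>7n+5\<close> to the exponent of \<open>\<bar>q\<bar>\<close>,
  which outweighs all constants.\<close>

lemma pade_rem_decay:
  assumes q: "\<bar>q\<bar> \<le> 1/2" "q \<noteq> 0" and y: "\<bar>q\<bar> ^ n \<le> 1/3" and t: "0 < \<bar>t\<bar>" "\<bar>t\<bar> < 1"
  shows "\<bar>pade_rem q (Suc n) (q ^ Suc n * t) * pade_den q n (q ^ n * t)\<bar>
       < \<bar>pade_rem q n (q ^ n * t) * (pade_den q (Suc n) (q ^ Suc n * t) * (1 - q ^ n * t))\<bar>"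
proof -
  have "\<bar>q\<bar> * \<bar>q\<bar> ^ n \<le> 1/2 * (1/3)" using q y by (intro mult_mono) auto
  hence y': "\<bar>q\<bar> ^ Suc n \<le> 1/6" by simp
  have z: "\<bar>q ^ m * t\<bar> \<le> \<bar>q\<bar> ^ m" for m
    using mult_left_mono[of "\<bar>t\<bar>" 1 "\<bar>q\<bar> ^ m"] t by (simp add: abs_mult power_abs)
  define T where "T = \<bar>t\<bar> ^ (2 * n + 1) * \<bar>q\<bar> ^ rem_exp n"
  have T: "T > 0" using q t by (simp add: T_def)
  have R: "T / 50 \<le> \<bar>pade_rem q n (q ^ n * t)\<bar>"
    unfolding T_def by (rule abs_pade_rem_bounds(1)[OF q y t(2)])
  have "\<bar>pade_rem q (Suc n) (q ^ Suc n * t)\<bar> \<le> 3 * (\<bar>t\<bar> ^ (2 * Suc n + 1) * \<bar>q\<bar> ^ rem_exp (Suc n))"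
    using y' by (intro abs_pade_rem_bounds(2)[OF q _ t(2)]) simp
  also have "\<bar>t\<bar> ^ (2 * Suc n + 1) * \<bar>q\<bar> ^ rem_exp (Suc n) = T * (\<bar>t\<bar>\<^sup>2 * ((\<bar>q\<bar> ^ n) ^ 7 * \<bar>q\<bar> ^ 5))"
    unfolding rem_exp_Suc T_def by (simp add: power_add power2_eq_square mult_ac flip: power_mult)
  also have "\<dots> \<le> T * (1 * ((1/3) ^ 7 * (1/2) ^ 5))"
    using T t q y by (intro mult_left_mono mult_mono power_mono power_le_one) auto
  finally have R': "\<bar>pade_rem q (Suc n) (q ^ Suc n * t)\<bar> \<le> T / 23328" by (simp add: power_divide)
  have "\<bar>pade_den q n (q ^ n * t)\<bar> \<le> exp (3 * \<bar>q\<bar> ^ n)" by (rule abs_pade_den_le[OF q(1) z])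
  also have "\<dots> \<le> exp 1" using y by simp
  also have "\<dots> \<le> 3" by (rule exp_le)
  finally have Q: "\<bar>pade_den q n (q ^ n * t)\<bar> \<le> 3" .
  have Q': "1/3 \<le> \<bar>pade_den q (Suc n) (q ^ Suc n * t)\<bar>" by (rule abs_pade_den_ge[OF q(1) y' z])
  have f: "2/3 \<le> \<bar>1 - q ^ n * t\<bar>" using z[of n] y by linarith
  have "\<bar>pade_rem q (Suc n) (q ^ Suc n * t) * pade_den q n (q ^ n * t)\<bar> \<le> T / 23328 * 3"
    unfolding abs_mult using R' Q T by (intro mult_mono) auto
  also have "\<dots> < T / 50 * (1/3 * (2/3))" using T by simp
  also have "\<dots> \<le> \<bar>pade_rem q n (q ^ n * t) * (pade_den q (Suc n) (q ^ Suc n * t) * (1 - q ^ n * t))\<bar>"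
    unfolding abs_mult using R Q' f T by (intro mult_mono) auto
  finally show ?thesis .
qed

section \<open>The lower bound\<close>

text \<open>The nonzero integer \<open>N * B - M * A\<close> has size at least 1, and the small
  linear form can absorb at most half of it.\<close>

lemma rational_approximation_bound:
  fixes E A B :: real and M N :: int
  assumes "A \<in> \<int>" "B \<in> \<int>" "N \<noteq> 0" and small: "2 * \<bar>of_int N\<bar> * \<bar>A * E - B\<bar> \<le> 1"
    and ne: "of_int N * B \<noteq> of_int M * A"
  shows "1 \<le> 2 * \<bar>of_int N\<bar> * \<bar>A\<bar> * \<bar>E - of_int M / of_int N\<bar>"
proof -
  obtain a b where ab: "A = of_int a" "B = of_int b" using assms by (auto elim!: Ints_cases)
  have "N * b - M * a \<noteq> 0" using ne unfolding ab by (metis of_int_mult right_minus_eq)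
  hence "1 \<le> \<bar>N * b - M * a\<bar>" by linarith
  hence "1 \<le> \<bar>of_int N * B - of_int M * A\<bar>"
    unfolding ab by (metis of_int_1_le_iff of_int_abs of_int_diff of_int_mult)
  moreover have "of_int N * A * (E - of_int M / of_int N) = of_int N * (A * E - B) + (of_int N * B - of_int M * A)"
    using \<open>N \<noteq> 0\<close> by (simp add: field_simps)
  moreover have "\<bar>of_int N * (A * E - B)\<bar> \<le> 1/2" using small by (simp add: abs_mult)
  ultimately have "1/2 \<le> \<bar>of_int N * A * (E - of_int M / of_int N)\<bar>" by linarith
  thus ?thesis by (simp add: abs_mult)
qed

definition pade_scale :: "int \<Rightarrow> int \<Rightarrow> nat \<Rightarrow> real" where
  "pade_scale d v n = of_int v ^ (2 * n) * of_int d ^ (2 * n\<^sup>2)"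

lemma consecutive_approximation_bound:
  fixes d u v M N :: int
  assumes d: "\<bar>d\<bar> \<ge> 2" and v: "v > 0" and q: "q = 1 / of_int d" and t: "t = of_int u / of_int v"
    and t01: "0 < \<bar>t\<bar>" "\<bar>t\<bar> < 1" and N: "N \<noteq> 0" and y: "\<bar>q\<bar> ^ n \<le> 1/3"
    and small: "\<And>m. m \<in> {n, Suc n} \<Longrightarrow> 2 * \<bar>of_int N\<bar> * \<bar>pade_scale d v m * pade_rem q m (q ^ m * t)\<bar> \<le> 1"
  shows "\<exists>m\<in>{n, Suc n}. 1 \<le> 2 * \<bar>of_int N\<bar> * \<bar>pade_scale d v m * (pade_den q m (q ^ m * t) * (\<Prod>k<m. 1 - q ^ k * t))\<bar>
           * \<bar>q_exp q t - of_int M / of_int N\<bar>"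
proof (rule ccontr)
  assume contr: "\<not> ?thesis"
  define E where "E = q_exp q t"
  define P where "P = (\<lambda>m. \<Prod>k<m. 1 - q ^ k * t)"
  define Q where "Q = (\<lambda>m. pade_den q m (q ^ m * t))"
  define R where "R = (\<lambda>m. pade_rem q m (q ^ m * t))"
  define B where "B = (\<lambda>m. pade_num q m (q ^ m * t))"
  have "\<bar>real_of_int d\<bar> \<ge> 2" using d by linarith
  hence q2: "\<bar>q\<bar> \<le> 1/2" "q \<noteq> 0" unfolding q by (auto simp: abs_divide divide_simps)
  hence q1: "\<bar>q\<bar> < 1" by simp
  have z: "\<bar>q ^ m * t\<bar> < 1" for m
  proof -
    have "\<bar>q ^ m\<bar> \<le> 1" using q1 by (simp add: power_abs power_le_one)
    hence "\<bar>q ^ m\<bar> * \<bar>t\<bar> \<le> 1 * \<bar>t\<bar>" by (intro mult_right_mono) auto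
    thus ?thesis using t01(2) unfolding abs_mult by linarith
  qed
  have R: "Q m * P m * E - B m = R m" for m
    unfolding R_def pade_rem_eq[OF q1 z] q_exp_shift_power[OF q1 t01(2)] by (simp add: Q_def P_def B_def E_def)
  \<comment> \<open>If the bound fails for \<open>m\<close>, then \<open>M/N\<close> must be the
    \<open>m\<close>-th approximant; the form used here needs no division by \<open>Q m\<close> or
    \<open>P m\<close>.\<close>
  have eq: "Q m * P m * (E - of_int M / of_int N) = R m" if m: "m \<in> {n, Suc n}" for m
  proof -
    have K: "pade_scale d v m \<noteq> 0" using d v by (auto simp: pade_scale_def)
    have r: "pade_scale d v m * (Q m * P m) * E - pade_scale d v m * B m = pade_scale d v m * R m"
      unfolding R[symmetric] by (simp add: algebra_simps)
    have "pade_scale d v m * (Q m * P m) \<in> \<int>"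
      using d pade_den_integral[OF _ v q t] by (auto simp: pade_scale_def Q_def P_def)
    moreover have "pade_scale d v m * B m \<in> \<int>"
      using pade_num_integral[OF d v q t] by (simp add: pade_scale_def B_def)
    moreover have "2 * \<bar>of_int N\<bar> * \<bar>pade_scale d v m * (Q m * P m) * E - pade_scale d v m * B m\<bar> \<le> 1"
      unfolding r using small[OF m] by (simp add: R_def)
    ultimately have "of_int N * (pade_scale d v m * B m) = of_int M * (pade_scale d v m * (Q m * P m))"
      using rational_approximation_bound[OF _ _ N, of "pade_scale d v m * (Q m * P m)" "pade_scale d v m * B m" E M] contr m
      unfolding E_def P_def Q_def by blast
    hence "of_int N * B m = of_int M * (Q m * P m)" using K by (simp add: mult.left_commute)
    hence "B m = Q m * P m * (of_int M / of_int N)" using N by (simp add: field_simps)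
    thus ?thesis using R[of m] by (simp add: algebra_simps)
  qed
  have "R (Suc n) * Q n = Q (Suc n) * (1 - q ^ n * t) * (Q n * P n * (E - of_int M / of_int N))"
    using eq[of "Suc n"] by (simp add: P_def mult_ac)
  also have "\<dots> = R n * (Q (Suc n) * (1 - q ^ n * t))"
    using eq[of n] by simp
  finally show False
    using pade_rem_decay[OF q2 y t01] by (simp add: R_def Q_def)
qed

text \<open>
  Applied with \<open>w = 4 log v / (3 log |d|)\<close>, \<open>s\<^sup>2 = log 4 / log |d|\<close> and
  \<open>x\<^sup>2 = 2 log (2|N|) / (3 log |d|)\<close>: the second property says that \<open>2|N|\<close> times the linear form is
  at most 1, the third is the final comparison of exponents for the index \<open>n + 1\<close>, divided by
  \<open>log |d|\<close>. The first property excludes only \<open>n = 0\<close> and \<open>|d| = 2, n = 1\<close>, where the leading term of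
  the remainder series need not exceed the sum of the absolute values of the others.
\<close>
lemma exists_degree:
  fixes w x s :: real and d :: nat
  assumes d: "d \<ge> 2" and w: "w \<ge> 0" and x: "x \<ge> 0" and s: "s \<ge> 0" and s2: "d = 2 \<Longrightarrow> s\<^sup>2 = 2"
  obtains n where "3 \<le> d ^ n" "x\<^sup>2 + s\<^sup>2 \<le> real n * (real n + 1 - w)"
    "2 * (real n + 1)\<^sup>2 + 3/2 * w * (real n + 1) + 3/2 * s\<^sup>2
       \<le> 7/2 * w\<^sup>2 + 7/2 * w * s + 8 * s + 11 * w + 8 + 7/2 * s\<^sup>2 + 2 * x\<^sup>2 + x * (11/2 * w + 8 + 4 * s)"
proof -
  define P where "P = (\<lambda>n. 3 \<le> d ^ n \<and> x\<^sup>2 + s\<^sup>2 \<le> real n * (real n + 1 - w))"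
  have nn: "0 \<le> w * x" "0 \<le> w * s" "0 \<le> x * s" "0 \<le> w\<^sup>2" "0 \<le> x\<^sup>2" "0 \<le> s\<^sup>2"
    using w x s by auto
  have "\<exists>n. P n"
  proof
    \<comment> \<open>With this size both \<open>n\<close> and \<open>n + 1 - w\<close> exceed
      \<open>x + s\<close>; the summand 2 gives \<open>3 \<le> 2^2 \<le> d^n\<close>.\<close>
    define n where "n = nat \<lceil>x + s + w\<rceil> + 2"
    have n: "real n \<ge> x + s + w + 2" unfolding n_def using w x s by simp linarith
    have "x\<^sup>2 + s\<^sup>2 \<le> (x + s) * (x + s)" using nn by (simp add: algebra_simps power2_eq_square)
    also have "\<dots> \<le> real n * (real n + 1 - w)" using n w x s by (intro mult_mono) auto
    finally have xs: "x\<^sup>2 + s\<^sup>2 \<le> real n * (real n + 1 - w)" .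
    have "(3::nat) \<le> 2 ^ 2" by simp
    also have "\<dots> \<le> d ^ 2" using d by (intro power_mono) auto
    also have "\<dots> \<le> d ^ n" using d by (intro power_increasing) (auto simp: n_def)
    finally have "3 \<le> d ^ n" .
    with xs show "P n" by (simp add: P_def)
  qed
  define n where "n = (LEAST n. P n)"
  have "P n" unfolding n_def using \<open>\<exists>n. P n\<close> by (rule LeastI_ex)
  have "n \<noteq> 0" using \<open>P n\<close> by (auto simp: P_def intro: ccontr)
  then obtain p where p: "n = Suc p" by (cases n) auto
  have "\<not> P p" using not_less_Least[of p P] p by (simp add: n_def)
  have "2 * (real n + 1)\<^sup>2 + 3/2 * w * (real n + 1) + 3/2 * s\<^sup>2
       \<le> 7/2 * w\<^sup>2 + 7/2 * w * s + 8 * s + 11 * w + 8 + 7/2 * s\<^sup>2 + 2 * x\<^sup>2 + x * (11/2 * w + 8 + 4 * s)"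
  \<comment> \<open>The predecessor \<open>p\<close> of the least index violates one of the two
    conditions: either \<open>p\<close> is very small, or the quadratic condition fails and bounds
    \<open>n\<close> from above.\<close>
  proof (cases "3 \<le> d ^ p")
    case False
    have "p = 0 \<or> p = 1 \<and> d = 2"
    proof (cases "p = 0")
      case False
      have "d ^ 1 \<le> d ^ p" using d False by (intro power_increasing) auto
      hence "d = 2" using \<open>\<not> 3 \<le> d ^ p\<close> d by simp
      moreover have "\<not> 2 \<le> p"
      proof
        assume "2 \<le> p"
        hence "(2::nat) ^ 2 \<le> 2 ^ p" by (intro power_increasing) auto
        thus False using \<open>\<not> 3 \<le> d ^ p\<close> \<open>d = 2\<close> by simp
      qed
      ultimately show ?thesis using False by auto
    qed auto
    thus ?thesis
    proof
      assume "p = 0"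
      thus ?thesis using nn w x s p by (simp add: algebra_simps)
    next
      \<comment> \<open>With \<open>n = 2\<close> and \<open>s^2 = 2\<close> the left side is
        \<open>21 + 9/2 * w\<close>, while the right side is at least
        \<open>8 * s + 11 * w + 15 \<ge> 23 + 11 * w\<close>.\<close>
      assume *: "p = 1 \<and> d = 2"
      hence "s\<^sup>2 = 2" using s2 by simp
      moreover have "1 \<le> s"
        using \<open>s\<^sup>2 = 2\<close> power2_le_imp_le[of 1 s] s by simp
      moreover have "0 \<le> 7/2 * w\<^sup>2 + 7/2 * w * s + 2 * x\<^sup>2 + x * (11/2 * w + 8 + 4 * s)"
        using w x s by (intro add_nonneg_nonneg mult_nonneg_nonneg) auto
      moreover have "2 * (real n + 1)\<^sup>2 + 3/2 * w * (real n + 1) = 18 + 9/2 * w"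
        using * p by simp
      ultimately show ?thesis using w by linarith
    qed
  next
    case True
    hence less: "(real n - 1) * (real n - w) < x\<^sup>2 + s\<^sup>2"
      using \<open>\<not> P p\<close> by (simp add: P_def p algebra_simps)
    have le: "real n \<le> x + s + max 1 w"
    proof (rule ccontr)
      assume "\<not> ?thesis"
      hence "(x + s) * (x + s) \<le> (real n - 1) * (real n - w)"
        using x s by (intro mult_mono) auto
      moreover have "x\<^sup>2 + s\<^sup>2 \<le> (x + s) * (x + s)" using nn by (simp add: algebra_simps power2_eq_square)
      ultimately show False using less by linarith
    qed
    \<comment> \<open>Substituting \<open>n^2 = (n-1)(n-w) + n + w*n - w\<close> and the failed
      condition leaves only this linear term in \<open>n\<close> to estimate.\<close>
    have "(6 + 7/2 * w) * real n \<le> (6 + 7/2 * w) * (x + s + max 1 w)"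
      using le w by (intro mult_left_mono) auto
    also have "\<dots> \<le> 7/2 * w\<^sup>2 + 7/2 * w * s + 8 * s + 23/2 * w + 6 + x * (11/2 * w + 8 + 4 * s)"
    proof (cases "w \<le> 1")
      case True
      have "0 \<le> 7/2 * w\<^sup>2 + 2 * s + 8 * w + x * (2 * w + 2 + 4 * s)"
        using w x s by (intro add_nonneg_nonneg mult_nonneg_nonneg) auto
      moreover have "max 1 w = 1" using True by simp
      ultimately show ?thesis by (simp add: algebra_simps)
    next
      case False
      have "0 \<le> 2 * s + 11/2 * w + 6 + x * (2 * w + 2 + 4 * s)"
        using w x s by (intro add_nonneg_nonneg mult_nonneg_nonneg) auto
      moreover have "7/2 * w\<^sup>2 + 7/2 * w * s + 8 * s + 23/2 * w + 6 + x * (11/2 * w + 8 + 4 * s)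
          = (6 + 7/2 * w) * (x + s + w) + (2 * s + 11/2 * w + 6 + x * (2 * w + 2 + 4 * s))"
        by (simp add: field_simps power2_eq_square)
      moreover have "max 1 w = w" using False by simp
      ultimately show ?thesis by linarith
    qed
    finally have "(6 + 7/2 * w) * real n \<le> \<dots>" .
    moreover have "(real n)\<^sup>2 = (real n - 1) * (real n - w) + real n + w * real n - w"
      by (simp add: algebra_simps power2_eq_square)
    moreover have "2 * (real n + 1)\<^sup>2 + 3/2 * w * (real n + 1) = 2 * (real n)\<^sup>2 + 4 * real n + 2 + 3/2 * (w * real n) + 3/2 * w"
      by (simp add: algebra_simps power2_eq_square)
    moreover have "(6 + 7/2 * w) * real n = 6 * real n + 7/2 * (w * real n)"
      by (simp add: algebra_simps)
    ultimately show ?thesis using less by linarith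
  qed
  thus ?thesis using \<open>P n\<close> that by (auto simp: P_def)
qed

lemma prod_le_prodinf_one_plus:
  "(\<Prod>k<m. 1 + 1 / 2 ^ k :: real) \<le> (\<Prod>k. 1 + 1 / 2 ^ k)"
  and prodinf_one_plus_ge_1: "1 \<le> (\<Prod>k. 1 + 1 / 2 ^ k :: real)"
proof -
  have "summable (\<lambda>k. (1/2) ^ k :: real)" by (rule summable_geometric) simp
  hence "convergent_prod (\<lambda>k. 1 + 1 / 2 ^ k :: real)"
  proof (intro summable_imp_convergent_prod_real)
    fix k
    have "(0::real) \<le> 1 / 2 ^ k" by simp
    thus "1 / 2 ^ k \<noteq> (- 1::real)" by linarith
  qed (simp add: power_one_over)
  hence p: "(\<lambda>k. 1 + 1 / 2 ^ k :: real) has_prod (\<Prod>k. 1 + 1 / 2 ^ k)"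
    by (rule convergent_prod_has_prod)
  show "(\<Prod>k<m. 1 + 1 / 2 ^ k :: real) \<le> (\<Prod>k. 1 + 1 / 2 ^ k)"
    by (rule prod_le_prodinf[OF p]) (auto intro!: add_nonneg_nonneg)
  show "1 \<le> (\<Prod>k. 1 + 1 / 2 ^ k :: real)"
    by (rule prodinf_nonneg[OF p]) auto
qed

theorem theorem1:
  fixes d u v :: int and q t :: real
  assumes "\<bar>d\<bar> \<ge> 2"
    and "q = 1 / of_int d"
    and "v > 0"
    and "gcd u v = 1"
    and "t = of_int u / of_int v"
    and "0 < \<bar>t\<bar>" and "\<bar>t\<bar> < 1"
  shows "\<forall>M N :: int. \<bar>N\<bar> \<ge> 1 \<longrightarrow>
           \<bar>q_exp q t - of_int M / of_int N\<bar>
             \<ge> C1 d v * (2 * \<bar>of_int N\<bar>) powr (- (7 / 3 + eps1 v d N))"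
proof (intro allI impI)
  fix M N :: int
  assume N: "\<bar>N\<bar> \<ge> 1"
  define b where "b = \<bar>real_of_int d\<bar>"
  define D where "D = ln b"
  define V where "V = ln (real_of_int v)"
  define L where "L = ln (2 * \<bar>real_of_int N\<bar>)"
  define Pinf where "Pinf = (\<Prod>k. 1 + 1 / 2 ^ k :: real)"
  define w where "w = 4 * V / (3 * D)"
  define s where "s = sqrt (ln 4 * D) / D"
  define x where "x = sqrt (2 * L / (3 * D))"
  have b: "b \<ge> 2" using assms(1) unfolding b_def by linarith
  have v: "real_of_int v \<ge> 1" using \<open>v > 0\<close> by linarith
  have "\<bar>real_of_int N\<bar> \<ge> 1" using N by linarith
  hence N2: "2 * \<bar>real_of_int N\<bar> = exp L" and L: "L > 0" by (auto simp: L_def)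
  have bD: "b = exp D" and D: "D > 0" using b by (auto simp: D_def)
  have vV: "real_of_int v = exp V" and V: "V \<ge> 0" using v by (auto simp: V_def)
  have Pinf: "Pinf \<ge> 1" unfolding Pinf_def by (rule prodinf_one_plus_ge_1)
  have ln4: "ln 4 = 2 * ln (2::real)" and ln8: "ln 8 = 3 * ln (2::real)"
    using ln_realpow[of "2::real" 2] ln_realpow[of "2::real" 3] by simp_all
  have w: "w \<ge> 0" "V = 3/4 * D * w" using V D by (auto simp: w_def)
  have x: "x > 0" "L = 3/2 * D * x\<^sup>2" using L D by (auto simp: x_def)
  have s: "s \<ge> 0" "sqrt (ln 4 * D) = D * s" using D by (auto simp: s_def)
  have s2: "D * s\<^sup>2 = 2 * ln 2"
    using D by (simp add: s_def power_divide ln4 power2_eq_square)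
  hence ln2: "ln 2 = D * s\<^sup>2 / 2" by simp
  have q: "\<bar>q\<bar> = exp (- D)" unfolding assms(2) by (simp add: exp_minus bD[symmetric] b_def divide_inverse)
  have q2: "\<bar>q\<bar> \<le> 1/2" "q \<noteq> 0"
  proof -
    show "\<bar>q\<bar> \<le> 1/2" using b unfolding q exp_minus bD[symmetric] by (simp add: divide_simps)
    show "q \<noteq> 0" using assms(1,2) by auto
  qed
  obtain n where n: "3 \<le> nat \<bar>d\<bar> ^ n" "x\<^sup>2 + s\<^sup>2 \<le> real n * (real n + 1 - w)"
    "2 * (real n + 1)\<^sup>2 + 3/2 * w * (real n + 1) + 3/2 * s\<^sup>2
       \<le> 7/2 * w\<^sup>2 + 7/2 * w * s + 8 * s + 11 * w + 8 + 7/2 * s\<^sup>2 + 2 * x\<^sup>2 + x * (11/2 * w + 8 + 4 * s)"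
  proof (rule exists_degree[of "nat \<bar>d\<bar>" w x s])
    assume "nat \<bar>d\<bar> = 2"
    hence "b = 2" unfolding b_def by linarith
    thus "s\<^sup>2 = 2" using s2 by (simp add: D_def)
  qed (use assms(1) w x s in auto)
  have "3 \<le> real (nat \<bar>d\<bar> ^ n)" using n(1) by linarith
  also have "\<dots> = b ^ n" by (simp add: b_def)
  finally have b3: "3 \<le> b ^ n" .
  have y: "\<bar>q\<bar> ^ n \<le> 1/3" if "3 \<le> b ^ n" for n
    using that unfolding q exp_minus bD[symmetric] by (simp add: power_inverse divide_simps)
  have scale: "\<bar>pade_scale d v m\<bar> = exp (2 * real m * V + 2 * (real m)\<^sup>2 * D)" for m
  proof -
    have "\<bar>pade_scale d v m\<bar> = exp V ^ (2 * m) * exp D ^ (2 * m\<^sup>2)"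
      unfolding pade_scale_def abs_mult power_abs vV[symmetric] bD[symmetric] b_def using \<open>v > 0\<close> by simp
    thus ?thesis by (simp add: exp_add flip: exp_of_nat_mult)
  qed
  \<comment> \<open>The quadratic condition passes to \<open>Suc n\<close>: since its left side is
    positive, the factor \<open>n + 1 - w\<close> cannot be negative.\<close>
  have mono: "real n * (real n + 1 - w) \<le> (real n + 1) * (real n + 2 - w)"
  proof -
    have "0 < x\<^sup>2 + s\<^sup>2" using x by (simp add: add_pos_nonneg)
    hence "0 < real n * (real n + 1 - w)" using n(2) by linarith
    hence "0 \<le> real n + 1 - w" by (simp add: zero_less_mult_iff)
    thus ?thesis by (intro mult_mono) auto
  qed
  have m: "3 \<le> b ^ m \<and> x\<^sup>2 + s\<^sup>2 \<le> real m * (real m + 1 - w)" if "m \<in> {n, Suc n}" for m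
  proof -
    have "b ^ n \<le> b ^ Suc n" using b by (intro power_increasing) auto
    moreover have "real (Suc n) * (real (Suc n) + 1 - w) = (real n + 1) * (real n + 2 - w)"
      by (simp add: algebra_simps)
    ultimately have "3 \<le> b ^ Suc n \<and> x\<^sup>2 + s\<^sup>2 \<le> real (Suc n) * (real (Suc n) + 1 - w)"
      using n(2) mono b3 by linarith
    thus ?thesis using that n(2) b3 by blast
  qed
  have small: "2 * \<bar>of_int N\<bar> * \<bar>pade_scale d v m * pade_rem q m (q ^ m * t)\<bar> \<le> 1" if "m \<in> {n, Suc n}" for m
  proof -
    have "\<bar>pade_rem q m (q ^ m * t)\<bar> \<le> 3 * (\<bar>t\<bar> ^ (2 * m + 1) * \<bar>q\<bar> ^ rem_exp m)"
      using m[OF that] by (intro abs_pade_rem_bounds q2 y assms) auto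
    \<comment> \<open>The constant 3 is relaxed to 8 because \<open>ln 8 = 3/2 * D * s^2\<close>,
      which matches the \<open>s^2\<close> in the choice of \<open>n\<close>.\<close>
    also have "\<dots> \<le> 8 * (1 * \<bar>q\<bar> ^ rem_exp m)"
      using \<open>\<bar>t\<bar> < 1\<close> by (intro mult_mono power_le_one) auto
    also have "\<dots> = exp (ln 8 - real (rem_exp m) * D)"
      by (simp add: q exp_diff exp_minus divide_inverse power_inverse flip: exp_of_nat_mult)
    finally have R: "\<bar>pade_rem q m (q ^ m * t)\<bar> \<le> \<dots>" .
    have "2 * \<bar>of_int N\<bar> * \<bar>pade_scale d v m * pade_rem q m (q ^ m * t)\<bar>
        \<le> exp L * (exp (2 * real m * V + 2 * (real m)\<^sup>2 * D) * exp (ln 8 - real (rem_exp m) * D))"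
      unfolding N2 abs_mult scale using R by (intro mult_left_mono) auto
    also have "\<dots> = exp (L + (2 * real m * V + 2 * (real m)\<^sup>2 * D) + (ln 8 - real (rem_exp m) * D))"
      by (simp add: exp_add mult.assoc)
    also have "\<dots> \<le> 1"
    proof -
      have "real (2 * rem_exp m) = real (7 * m\<^sup>2 + 3 * m)" by (simp only: two_rem_exp)
      hence e: "real (rem_exp m) = 7/2 * (real m)\<^sup>2 + 3/2 * real m" by simp
      \<comment> \<open>The quadratic parts give \<open>2m^2 - (7m^2 + 3m)/2 = -3m(m+1)/2\<close>,
        and \<open>2mV = 3/2 * D * w * m\<close> supplies the \<open>-w\<close>.\<close>
      have "L + (2 * real m * V + 2 * (real m)\<^sup>2 * D) + (ln 8 - real (rem_exp m) * D)
          = 3/2 * D * x\<^sup>2 + 3/2 * (D * s\<^sup>2) - 3/2 * D * (real m * (real m + 1 - w))"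
        unfolding e ln8 s2 x(2) w(2) by (simp add: algebra_simps power2_eq_square)
      also have "\<dots> = 3/2 * D * ((x\<^sup>2 + s\<^sup>2) - real m * (real m + 1 - w))"
        by (simp add: algebra_simps)
      also have "\<dots> \<le> 0" using m[OF that] D by (intro mult_nonneg_nonpos) auto
      finally show ?thesis by simp
    qed
    finally show ?thesis .
  qed
  have "N \<noteq> 0" using N by auto
  from consecutive_approximation_bound[OF assms(1,3,2,5-7) this y[OF b3] small, of M]
  obtain m where mn: "m \<in> {n, Suc n}" and one:
    "1 \<le> 2 * \<bar>of_int N\<bar> * \<bar>pade_scale d v m * (pade_den q m (q ^ m * t) * (\<Prod>k<m. 1 - q ^ k * t))\<bar>
           * \<bar>q_exp q t - of_int M / of_int N\<bar>" by blast
  have "\<bar>pade_scale d v m * (pade_den q m (q ^ m * t) * (\<Prod>k<m. 1 - q ^ k * t))\<bar>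
      \<le> exp (2 * real m * V + 2 * (real m)\<^sup>2 * D) * (8 * Pinf)"
    unfolding abs_mult scale
  proof (intro mult_left_mono mult_mono)
    have "\<bar>q\<bar> ^ m * \<bar>t\<bar> \<le> \<bar>q\<bar> ^ m * 1" using \<open>\<bar>t\<bar> < 1\<close> by (intro mult_left_mono) auto
    hence "\<bar>pade_den q m (q ^ m * t)\<bar> \<le> exp (3 * \<bar>q\<bar> ^ m)"
      by (intro abs_pade_den_le q2) (simp add: abs_mult power_abs)
    also have "\<dots> \<le> exp 1" using y m[OF mn] by force
    also have "\<dots> \<le> 8" using exp_le by simp
    finally show "\<bar>pade_den q m (q ^ m * t)\<bar> \<le> 8" .
    have "\<bar>\<Prod>k<m. 1 - q ^ k * t\<bar> \<le> (\<Prod>k<m. 1 + 1 / 2 ^ k)"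
      unfolding abs_prod
    proof (intro prod_mono conjI)
      fix k
      have "\<bar>q\<bar> ^ k * \<bar>t\<bar> \<le> (1/2) ^ k * 1"
        using q2 \<open>\<bar>t\<bar> < 1\<close> by (intro mult_mono power_mono) auto
      hence "\<bar>q ^ k * t\<bar> \<le> 1 / 2 ^ k" by (simp add: abs_mult power_abs power_one_over)
      thus "\<bar>1 - q ^ k * t\<bar> \<le> 1 + 1 / 2 ^ k" by linarith
    qed auto
    also have "\<dots> \<le> Pinf" unfolding Pinf_def by (rule prod_le_prodinf_one_plus)
    finally show "\<bar>\<Prod>k<m. 1 - q ^ k * t\<bar> \<le> Pinf" .
  qed auto
  also have "\<dots> = exp (2 * real m * V + 2 * (real m)\<^sup>2 * D + (ln 8 + ln Pinf))"
    using Pinf by (simp add: exp_add)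
  \<comment> \<open>Which of the two indices occurs is unknown, so the larger one is used.\<close>
  also have "\<dots> \<le> exp (2 * (real n + 1) * V + 2 * (real n + 1)\<^sup>2 * D + (ln 8 + ln Pinf))"
  proof -
    have "real m \<le> real n + 1" using mn by auto
    thus ?thesis using V D by (auto intro!: add_mono mult_right_mono power_mono)
  qed
  finally have A: "\<bar>pade_scale d v m * (pade_den q m (q ^ m * t) * (\<Prod>k<m. 1 - q ^ k * t))\<bar> \<le> \<dots>" (is "_ \<le> exp ?a") .
  have "2 * \<bar>of_int N\<bar> * \<bar>pade_scale d v m * (pade_den q m (q ^ m * t) * (\<Prod>k<m. 1 - q ^ k * t))\<bar>
           * \<bar>q_exp q t - of_int M / of_int N\<bar> \<le> exp L * exp ?a * \<bar>q_exp q t - of_int M / of_int N\<bar>"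
    unfolding N2 using A by (intro mult_left_mono mult_right_mono) auto
  from order_trans[OF one this] have "1 \<le> exp (L + ?a) * \<bar>q_exp q t - of_int M / of_int N\<bar>"
    by (simp only: exp_add[of L])
  moreover have "exp (- a) \<le> y" if "1 \<le> exp a * y" for a y :: real
    using that by (simp add: exp_minus divide_simps mult.commute)
  ultimately have lower: "exp (- (L + ?a)) \<le> \<bar>q_exp q t - of_int M / of_int N\<bar>"
    by blast
  have c4: "c4 d v = D * (7/2 * w\<^sup>2 + 7/2 * w * s + 8 * s + 11 * w + 8) + 7 * ln 2 + ln Pinf"
  proof -
    have "ln (2 ^ 7 * real_of_int v powr (44/3) * b ^ 8 * Pinf) = 7 * ln 2 + 44/3 * V + 8 * D + ln Pinf"
      using Pinf b v ln_realpow[of "2::real" 7] by (simp add: ln_mult ln_powr ln_realpow V_def D_def)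
    hence "c4 d v = 14 * V / (3 * D) * (4/3 * V + D * s) + 8 * (D * s) + (7 * ln 2 + 44/3 * V + 8 * D + ln Pinf)"
      unfolding c4_def s(2)[symmetric] by (simp add: V_def D_def b_def Pinf_def)
    also have "\<dots> = D * (7/2 * w\<^sup>2 + 7/2 * w * s + 8 * s + 11 * w + 8) + 7 * ln 2 + ln Pinf"
      unfolding w(2) using D by (simp add: field_simps power2_eq_square)
    finally show ?thesis .
  qed
  have eps: "eps1 v d N * L = D * (x * (11/2 * w + 8 + 4 * s))"
  proof -
    have "3/2 * D * L = (3/2 * D * x)\<^sup>2" by (simp add: x(2) power2_eq_square)
    hence "sqrt (3/2 * D * L) = 3/2 * D * x"
      using D x(1) by (intro real_sqrt_unique) auto
    hence "eps1 v d N = (22/3 * V + 8 * D + 4 * (D * s)) / (3/2 * D * x)"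
      unfolding eps1_def V_def[symmetric] b_def[symmetric] D_def[symmetric] L_def[symmetric]
      by (simp only: s(2))
    also have "\<dots> * L = D * (x * (11/2 * w + 8 + 4 * s))"
      unfolding w(2) x(2) using D x(1) by (simp add: field_simps power2_eq_square)
    finally show ?thesis .
  qed
  \<comment> \<open>After division by \<open>D\<close> this is the third property of
    \<open>n\<close>: \<open>2 * D * x^2 = 4/3 * L\<close> raises \<open>L\<close> to
    \<open>7/3 * L\<close>, \<open>7/2 * D * s^2\<close> is the \<open>7 * ln 2\<close> in
    \<open>c4\<close>, and the part linear in \<open>x\<close> is
    \<open>eps1 v d N * L\<close>.\<close>
  have "L + ?a \<le> c4 d v + (7/3 + eps1 v d N) * L"
  proof -
    have "L + ?a = L + D * (2 * (real n + 1)\<^sup>2 + 3/2 * w * (real n + 1) + 3/2 * s\<^sup>2) + ln Pinf"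
      unfolding w(2) ln8 ln2 by (simp add: field_simps)
    also have "\<dots> \<le> L + D * (7/2 * w\<^sup>2 + 7/2 * w * s + 8 * s + 11 * w + 8 + 7/2 * s\<^sup>2 + 2 * x\<^sup>2 + x * (11/2 * w + 8 + 4 * s)) + ln Pinf"
      by (intro add_right_mono add_left_mono mult_left_mono n(3) less_imp_le[OF D])
    also have "\<dots> = c4 d v + (7/3 * L + eps1 v d N * L)"
      unfolding c4 eps unfolding ln2 x(2) by (simp add: field_simps)
    finally show ?thesis by (simp only: distrib_right)
  qed
  hence "exp (- (c4 d v + (7/3 + eps1 v d N) * L)) \<le> exp (- (L + ?a))" by simp
  moreover have "C1 d v * (2 * \<bar>of_int N\<bar>) powr (- (7 / 3 + eps1 v d N)) = exp (- (c4 d v + (7/3 + eps1 v d N) * L))"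
    unfolding N2 C1_def by (simp add: powr_def exp_add[symmetric] algebra_simps)
  ultimately show "C1 d v * (2 * \<bar>of_int N\<bar>) powr (- (7 / 3 + eps1 v d N)) \<le> \<bar>q_exp q t - of_int M / of_int N\<bar>"
    using lower by linarith
qed

end
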